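(* Let $n\ge 3$, $0<m<\frac{n-2}{n}$, $\beta<0$ and $\alpha=\frac{2\beta}{1-m}$. Then for any constant $A>0$ there exists a unique solution $f=f_{\beta,A}$ of $$\frac{n-1}{m}\left((f^m)_{rr}+\frac{n-1}{r}(f^m)_r\right)+\alpha f+\beta r f_r=0,\quad f>0,\quad \forall r>0,$$ which satisfies $$\lim_{r\to\infty} r^{\frac{n-2}{m}}f(r)=A.$$ Moreover, $f$ satisfies $$\lim_{r\to 0}\frac{r^2 f(r)^{1-m}}{\log r^{-1}}=\frac{2(n-1)(n-2-nm)}{(1-m)|\beta|}$$ and $$\alpha f(r)+\beta r f_r(r)>0\quad\forall r>0.$$
   Context: Subscripts $r$ denote derivatives in $r$. Solutions of the ODE are positive classical ($C^2$) solutions on $(0,\infty)$; equivalently $f(|x|)$ is a radially symmetric solution of $\frac{n-1}{m}\Delta f^m+\alpha f+\beta x\cdot\nabla f=0$, $f>0$, in $\mathbb{R}^n\setminus\{0\}$. *)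

theory Defs
  imports "HOL-Analysis.Analysis"
begin

definition C2_on :: "real set \<Rightarrow> (real \<Rightarrow> real) \<Rightarrow> bool" where
  "C2_on S f \<longleftrightarrow>
     (\<forall>r\<in>S. f field_differentiable at r) \<and>
     (\<forall>r\<in>S. deriv f field_differentiable at r) \<and>
     continuous_on S (deriv (deriv f))"

text \<open>
  The radial profiles of positive classical solutions. Only the values of \<open>f\<close> on
  \<open>{0<..}\<close> matter; since that set is open, the two-sided derivatives
  at its points do not depend on \<open>f\<close> elsewhere.
\<close>

definition radial_solution ::
    "nat \<Rightarrow> real \<Rightarrow> real \<Rightarrow> real \<Rightarrow> (real \<Rightarrow> real) \<Rightarrow> bool" where
  "radial_solution n m \<alpha> \<beta> f \<longleftrightarrow>
     C2_on {0<..} f \<and>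
     (\<forall>r>0. f r > 0) \<and>
     (\<forall>r>0. (real n - 1) / m *
               (deriv (deriv (\<lambda>s. f s powr m)) r
                + (real n - 1) / r * deriv (\<lambda>s. f s powr m) r)
             + \<alpha> * f r + \<beta> * r * deriv f r = 0)"

end

theory Submission
  imports Defs
begin

text \<open>
  Write \<open>N = n - 2\<close>, \<open>u = f powr m\<close>, \<open>\<gamma> = 1 / m\<close>. After the Kelvin-type substitution
  \<open>t = r powr (- N)\<close>, the prescribed decay says that \<open>u / t\<close> tends to \<open>A powr m\<close> as \<open>t\<close> tends to 0.
  In the variable \<open>\<tau> = r\<^sup>2 * t powr (\<gamma> - 1)\<close>, the functions \<open>v = u / t\<close> and \<open>p = du / dt\<close> satisfy
  a system that is autonomous up to a regular singular point at \<open>\<tau> = 0\<close>: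
  \<open>\<sigma> * \<tau> * v' = p - v\<close> and \<open>p' = - K * v powr (\<gamma> - 1) * (p - \<theta> * v)\<close>.
  It is equivalent to a single Volterra equation for \<open>v\<close> with nonnegative kernel, whose right-hand side
  becomes globally Lipschitz after truncating the power at the a priori bound \<open>v \<le> A powr m\<close>; Picard
  iteration yields existence on the whole half line, and uniqueness. The inequality
  \<open>\<alpha> * f + \<beta> * r * f' > 0\<close> is \<open>p > \<theta> * v\<close>, which cannot fail for a first time because at such a
  point \<open>p - \<theta> * v\<close> would have positive derivative. For the blow-up rate put \<open>w = \<tau> * v powr (\<gamma> - 1)\<close>
  (which is \<open>r\<^sup>2 * f powr (1 - m)\<close>) and \<open>\<eta> = p / v - \<theta>\<close>: then \<open>w\<close> is increasing and unbounded, and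
  both \<open>\<eta>\<close> and \<open>w * \<eta>\<close>, the latter being proportional to \<open>dw / d(ln \<tau>)\<close>, relax to equilibrium
  at a rate of which the integral diverges.
\<close>

section \<open>A Volterra integral operator\<close>

text \<open>The kernel is \<open>(1 - \<theta>) + \<theta> * (y / x) powr a\<close>, so the operator is dominated by plain integration.\<close>

definition volterra :: "real \<Rightarrow> real \<Rightarrow> (real \<Rightarrow> real) \<Rightarrow> real \<Rightarrow> real" where
  "volterra \<theta> a \<phi> x =
     (1 - \<theta>) * integral {0..x} \<phi> + \<theta> * x powr (- a) * integral {0..x} (\<lambda>y. y powr a * \<phi> y)"

lemma continuous_on_powr_times:
  fixes a x :: real
  assumes "a > 0" "continuous_on {0..x} \<phi>"
  shows "continuous_on {0..x} (\<lambda>y. y powr a * \<phi> y)"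
  using assms by (intro continuous_on_mult continuous_on_powr' continuous_intros) auto

lemma volterra_diff:
  assumes "a > 0" "continuous_on {0..x} \<phi>" "continuous_on {0..x} \<psi>"
  shows "volterra \<theta> a \<phi> x - volterra \<theta> a \<psi> x = volterra \<theta> a (\<lambda>y. \<phi> y - \<psi> y) x"
proof -
  have "integral {0..x} (\<lambda>y. \<phi> y - \<psi> y) = integral {0..x} \<phi> - integral {0..x} \<psi>"
    using assms by (intro integral_diff integrable_continuous_interval)
  moreover have "integral {0..x} (\<lambda>y. y powr a * (\<phi> y - \<psi> y)) =
      integral {0..x} (\<lambda>y. y powr a * \<phi> y) - integral {0..x} (\<lambda>y. y powr a * \<psi> y)"
    unfolding right_diff_distrib using assms
    by (intro integral_diff integrable_continuous_interval continuous_on_powr_times)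
  ultimately show ?thesis
    by (simp only: volterra_def) (simp only: algebra_simps)
qed

lemma volterra_nonneg:
  assumes "0 \<le> \<theta>" "\<theta> \<le> 1" "a > 0" "continuous_on {0..x} \<phi>"
    and "\<And>y. y \<in> {0..x} \<Longrightarrow> \<phi> y \<ge> 0"
  shows "volterra \<theta> a \<phi> x \<ge> 0"
  unfolding volterra_def using assms
  by (intro add_nonneg_nonneg mult_nonneg_nonneg integral_nonneg integrable_continuous_interval
      continuous_on_powr_times) auto

text \<open>For \<open>0 < y \<le> x\<close> the kernel lies between 0 and 1, so the operator is no
  larger than plain integration of the bound. The extra power and the divisor \<open>Suc k\<close>
  produce the factorials in the iterations below.\<close>

lemma volterra_bound:
  assumes \<theta>: "0 \<le> \<theta>" "\<theta> \<le> 1" and "a > 0" "x \<ge> 0" and cont: "continuous_on {0..x} \<phi>"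
    and bound: "\<And>y. y \<in> {0..x} \<Longrightarrow> \<bar>\<phi> y\<bar> \<le> B * y ^ k"
  shows "\<bar>volterra \<theta> a \<phi> x\<bar> \<le> B * x ^ Suc k / Suc k"
proof (cases "x = 0")
  case True
  then show ?thesis by (simp add: volterra_def)
next
  case False
  with \<open>x \<ge> 0\<close> have x: "x > 0" by simp
  let ?I = "B * x ^ Suc k / Suc k"
  have I: "((\<lambda>y. B * y ^ k) has_integral ?I) {0..x}"
  proof -
    have "((\<lambda>y. B * y ^ k) has_integral (B * x ^ Suc k / Suc k - B * 0 ^ Suc k / Suc k)) {0..x}"
    proof (rule fundamental_theorem_of_calculus)
      show "((\<lambda>y. B * y ^ Suc k / Suc k) has_vector_derivative B * y ^ k) (at y within {0..x})" for y
        by (rule has_vector_derivative_at_within,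
            unfold has_real_derivative_iff_has_vector_derivative[symmetric])
           (rule derivative_eq_intros refl | simp)+
    qed (use x in auto)
    then show ?thesis by simp
  qed
  have 1: "\<bar>integral {0..x} \<phi>\<bar> \<le> ?I"
    using integral_norm_bound_integral[OF integrable_continuous_interval[OF cont]
        has_integral_integrable[OF I]] bound unfolding integral_unique[OF I] by simp
  have I': "((\<lambda>y. x powr a * (B * y ^ k)) has_integral x powr a * ?I) {0..x}"
    using I by (rule has_integral_mult_right)
  have "\<bar>integral {0..x} (\<lambda>y. y powr a * \<phi> y)\<bar> \<le> integral {0..x} (\<lambda>y. x powr a * (B * y ^ k))"
    unfolding real_norm_def[symmetric]
  proof (rule integral_norm_bound_integral)
    show "(\<lambda>y. y powr a * \<phi> y) integrable_on {0..x}"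
      using continuous_on_powr_times[OF \<open>a > 0\<close> cont] by (rule integrable_continuous_interval)
    show "(\<lambda>y. x powr a * (B * y ^ k)) integrable_on {0..x}"
      using I' by (rule has_integral_integrable)
    show "norm (y powr a * \<phi> y) \<le> x powr a * (B * y ^ k)" if "y \<in> {0..x}" for y
      using that bound[OF that] \<open>a > 0\<close>
      by (auto simp: abs_mult intro!: mult_mono powr_mono2)
  qed
  then have "x powr (- a) * \<bar>integral {0..x} (\<lambda>y. y powr a * \<phi> y)\<bar> \<le> x powr (- a) * (x powr a * ?I)"
    unfolding integral_unique[OF I'] by (intro mult_left_mono) auto
  then have 2: "\<bar>x powr (- a) * integral {0..x} (\<lambda>y. y powr a * \<phi> y)\<bar> \<le> ?I"
    using x by (simp add: abs_mult mult.assoc[symmetric] powr_add[symmetric])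
  have "\<bar>volterra \<theta> a \<phi> x\<bar> \<le> (1 - \<theta>) * \<bar>integral {0..x} \<phi>\<bar>
      + \<theta> * \<bar>x powr (- a) * integral {0..x} (\<lambda>y. y powr a * \<phi> y)\<bar>"
    unfolding volterra_def using \<theta>
    by (intro order_trans[OF abs_triangle_ineq]) (simp add: abs_mult mult.assoc)
  also have "\<dots> \<le> (1 - \<theta>) * ?I + \<theta> * ?I"
    using \<theta> 1 2 by (intro add_mono mult_left_mono) auto
  also have "\<dots> = ?I"
    unfolding distrib_right[symmetric] by simp
  finally show ?thesis .
qed

lemma integral_has_field_derivative:
  fixes \<phi> :: "real \<Rightarrow> real"
  assumes "continuous_on {0..} \<phi>" "x > 0"
  shows "((\<lambda>x. integral {0..x} \<phi>) has_real_derivative \<phi> x) (at x)"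
proof -
  have "((\<lambda>x. integral {0..x} \<phi>) has_real_derivative \<phi> x) (at x within {0..x+1})"
    using assms by (intro integral_has_real_derivative) (auto intro: continuous_on_subset)
  then show ?thesis
    using assms at_within_interior[of x "{0..x+1}"] by auto
qed

lemma continuous_on_ge_0I:
  fixes f :: "real \<Rightarrow> real"
  assumes "\<And>x. x > 0 \<Longrightarrow> isCont f x" "(f \<longlongrightarrow> f 0) (at_right 0)"
  shows "continuous_on {0..} f"
  unfolding continuous_on_def
proof
  fix x :: real assume "x \<in> {0..}"
  then consider "x > 0" | "x = 0" by fastforce
  then show "(f \<longlongrightarrow> f x) (at x within {0..})"
  proof cases
    case 1
    then show ?thesis using assms(1) by (simp add: isContD tendsto_within_subset[OF _ subset_UNIV])
  next
    case 2
    have "at 0 within {0..} = (at_right 0 :: real filter)"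
      by (simp add: at_within_def) (metis Diff_insert_absorb greaterThan_iff ivl_disj_un_singleton(1) order_less_irrefl insert_is_Un Un_commute Diff_insert2)
    then show ?thesis using assms(2) 2 by simp
  qed
qed

text \<open>For positive \<open>x\<close> both integrals are differentiable. At 0 the factor
  \<open>x powr (- a)\<close> is singular, so the limit there is read off from
  \<open>volterra_bound\<close> with \<open>k = 0\<close>, which gives the bound
  \<open>B * x\<close>.\<close>

lemma continuous_on_volterra:
  assumes \<theta>: "0 \<le> \<theta>" "\<theta> \<le> 1" and "a > 0" and cont: "continuous_on {0..} \<phi>"
  shows "continuous_on {0..} (volterra \<theta> a \<phi>)"
proof (rule continuous_on_ge_0I)
  fix x :: real assume x: "x > 0"
  have "continuous_on {0..} (\<lambda>y. y powr a * \<phi> y)"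
    using assms by (intro continuous_on_mult continuous_on_powr' continuous_intros) auto
  from integral_has_field_derivative[OF this x] integral_has_field_derivative[OF cont x]
  show "isCont (volterra \<theta> a \<phi>) x"
    unfolding volterra_def using x by (intro continuous_intros) (auto dest: DERIV_isCont)
next
  have "compact (\<phi> ` {0..1})"
    using cont by (intro compact_continuous_image) (auto intro: continuous_on_subset)
  then obtain B where B: "\<And>y. y \<in> {0..1} \<Longrightarrow> \<bar>\<phi> y\<bar> \<le> B"
    using compact_imp_bounded bounded_iff[of "\<phi> ` {0..1}"] that by fastforce
  have "((\<lambda>x. B * x) \<longlongrightarrow> B * 0) (at_right 0)"
    by (intro tendsto_intros)
  moreover have "eventually (\<lambda>x. norm (volterra \<theta> a \<phi> x) \<le> B * x) (at_right 0)"
    using eventually_at_right_real[OF zero_less_one]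
  proof eventually_elim
    case (elim x)
    have "\<bar>volterra \<theta> a \<phi> x\<bar> \<le> B * x ^ Suc 0 / Suc 0"
      using elim B by (intro volterra_bound \<theta> \<open>a > 0\<close> continuous_on_subset[OF cont]) auto
    then show ?case by simp
  qed
  ultimately have "(volterra \<theta> a \<phi> \<longlongrightarrow> 0) (at_right 0)"
    using Lim_null_comparison by (metis mult_zero_right)
  then show "(volterra \<theta> a \<phi> \<longlongrightarrow> volterra \<theta> a \<phi> 0) (at_right 0)"
    by (simp add: volterra_def)
qed

section \<open>Uniqueness and Picard iteration for the integral equation\<close>

lemma continuous_on_lipschitz_comp:
  fixes F :: "real \<Rightarrow> real"
  assumes "L \<ge> 0" "\<And>x y. \<bar>F x - F y\<bar> \<le> L * \<bar>x - y\<bar>" "continuous_on S \<phi>"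
  shows "continuous_on S (\<lambda>y. F (\<phi> y))"
proof -
  have "L-lipschitz_on UNIV F"
    using assms(1,2) by (intro lipschitz_onI) (auto simp: dist_real_def)
  then have "continuous_on UNIV F"
    by (rule lipschitz_on_continuous_on)
  then show ?thesis
    using assms(3) continuous_on_compose2 by blast
qed

lemma volterra_lipschitz:
  fixes F :: "real \<Rightarrow> real"
  assumes \<theta>: "0 \<le> \<theta>" "\<theta> \<le> 1" and "a > 0" "x \<ge> 0"
    and cont: "continuous_on {0..x} \<phi>" "continuous_on {0..x} \<psi>"
      "continuous_on {0..x} (\<lambda>y. F (\<phi> y))" "continuous_on {0..x} (\<lambda>y. F (\<psi> y))"
    and "L \<ge> 0" and lip: "\<And>y. y \<in> {0..x} \<Longrightarrow> \<bar>F (\<phi> y) - F (\<psi> y)\<bar> \<le> L * \<bar>\<phi> y - \<psi> y\<bar>"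
    and bound: "\<And>y. y \<in> {0..x} \<Longrightarrow> \<bar>\<phi> y - \<psi> y\<bar> \<le> B * y ^ k"
  shows "\<bar>volterra \<theta> a (\<lambda>y. F (\<phi> y)) x - volterra \<theta> a (\<lambda>y. F (\<psi> y)) x\<bar>
           \<le> L * B * x ^ Suc k / Suc k"
proof -
  have "\<bar>F (\<phi> y) - F (\<psi> y)\<bar> \<le> L * B * y ^ k" if "y \<in> {0..x}" for y
    using order_trans[OF lip[OF that] mult_left_mono[OF bound[OF that] \<open>L \<ge> 0\<close>]] by simp
  then show ?thesis
    unfolding volterra_diff[OF \<open>a > 0\<close> cont(3,4)]
    using assms by (intro volterra_bound continuous_intros) auto
qed

lemma abs_diff_affine:
  fixes C :: real
  assumes "C \<ge> 0"
  shows "\<bar>(P - C * x) - (P - C * y)\<bar> = C * \<bar>x - y\<bar>"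
proof -
  have "(P - C * x) - (P - C * y) = C * (y - x)"
    by (simp add: algebra_simps)
  then show ?thesis
    using assms by (simp add: abs_mult abs_minus_commute)
qed

text \<open>Passing the difference of the two fixed points through the equation \<open>k\<close>
  times bounds it by \<open>B * (C * L * x) ^ k / fact k\<close>, which tends to 0. The Lipschitz
  condition is asked only along the two given functions, so a power that is Lipschitz merely on a
  bounded range qualifies.\<close>

lemma volterra_fixpoint_unique:
  fixes F :: "real \<Rightarrow> real"
  assumes \<theta>: "0 \<le> \<theta>" "\<theta> \<le> 1" and "a > 0" "C \<ge> 0" "L \<ge> 0" "x \<ge> 0"
    and cont: "continuous_on {0..x} \<phi>" "continuous_on {0..x} \<psi>"
      "continuous_on {0..x} (\<lambda>y. F (\<phi> y))" "continuous_on {0..x} (\<lambda>y. F (\<psi> y))"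
    and lip: "\<And>y. y \<in> {0..x} \<Longrightarrow> \<bar>F (\<phi> y) - F (\<psi> y)\<bar> \<le> L * \<bar>\<phi> y - \<psi> y\<bar>"
    and fix\<phi>: "\<And>y. y \<in> {0..x} \<Longrightarrow> \<phi> y = P - C * volterra \<theta> a (\<lambda>z. F (\<phi> z)) y"
    and fix\<psi>: "\<And>y. y \<in> {0..x} \<Longrightarrow> \<psi> y = P - C * volterra \<theta> a (\<lambda>z. F (\<psi> z)) y"
  shows "\<phi> x = \<psi> x"
proof -
  have "continuous_on {0..x} (\<lambda>y. \<phi> y - \<psi> y)"
    using cont by (intro continuous_intros)
  then have "compact ((\<lambda>y. \<phi> y - \<psi> y) ` {0..x})"
    by (intro compact_continuous_image) auto
  then obtain B where B: "\<And>y. y \<in> {0..x} \<Longrightarrow> \<bar>\<phi> y - \<psi> y\<bar> \<le> B"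
    using compact_imp_bounded bounded_iff[of "(\<lambda>y. \<phi> y - \<psi> y) ` {0..x}"] that by fastforce
  have iter: "\<bar>\<phi> y - \<psi> y\<bar> \<le> (B * (C * L) ^ k / fact k) * y ^ k" if "y \<in> {0..x}" for y k
    using that
  proof (induction k arbitrary: y)
    case 0
    then show ?case using B by simp
  next
    case (Suc k)
    have "\<bar>\<phi> y - \<psi> y\<bar> = C * \<bar>volterra \<theta> a (\<lambda>z. F (\<phi> z)) y - volterra \<theta> a (\<lambda>z. F (\<psi> z)) y\<bar>"
      by (subst fix\<phi>[OF Suc.prems], subst fix\<psi>[OF Suc.prems]) (rule abs_diff_affine[OF \<open>C \<ge> 0\<close>])
    also have "\<dots> \<le> C * (L * (B * (C * L) ^ k / fact k) * y ^ Suc k / Suc k)"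
      using Suc \<theta> \<open>a > 0\<close> \<open>L \<ge> 0\<close> \<open>C \<ge> 0\<close> lip
      by (intro mult_left_mono volterra_lipschitz) (auto intro: continuous_on_subset[OF cont(1)]
          continuous_on_subset[OF cont(2)] continuous_on_subset[OF cont(3)] continuous_on_subset[OF cont(4)])
    also have "\<dots> = (B * (C * L) ^ Suc k / fact (Suc k)) * y ^ Suc k"
      by (simp add: divide_simps)
    finally show ?case .
  qed
  have "(\<lambda>k. B * (inverse (fact k) * (C * L * x) ^ k)) \<longlonglongrightarrow> B * 0"
    by (intro tendsto_intros summable_LIMSEQ_zero summable_exp)
  moreover have "\<forall>k\<ge>0. \<bar>\<phi> x - \<psi> x\<bar> \<le> B * (inverse (fact k) * (C * L * x) ^ k)"
    using iter[of x] \<open>x \<ge> 0\<close> by (simp add: power_mult_distrib divide_simps mult.assoc)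
  ultimately have "\<bar>\<phi> x - \<psi> x\<bar> \<le> B * 0"
    by (rule LIMSEQ_le_const[OF _ exI])
  then show ?thesis by simp
qed

text \<open>Picard iteration from the constant \<open>P\<close>: the increments are dominated by an
  exponential series, so the iterates converge uniformly on bounded intervals and the equation
  passes to the limit.\<close>

lemma volterra_fixpoint_exists:
  fixes F :: "real \<Rightarrow> real"
  assumes \<theta>: "0 \<le> \<theta>" "\<theta> \<le> 1" and "a > 0" "C \<ge> 0" "L \<ge> 0"
    and lip: "\<And>x y. \<bar>F x - F y\<bar> \<le> L * \<bar>x - y\<bar>"
  obtains v where "continuous_on {0..} v"
    and "\<And>x. x \<ge> 0 \<Longrightarrow> v x = P - C * volterra \<theta> a (\<lambda>y. F (v y)) x"
proof -
  define T where "T \<phi> x = P - C * volterra \<theta> a (\<lambda>y. F (\<phi> y)) x" for \<phi> x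
  define W where "W k = (T ^^ k) (\<lambda>_. P)" for k
  have W_Suc: "W (Suc k) = T (W k)" for k
    by (simp add: W_def)
  have contF: "continuous_on S (\<lambda>y. F (\<phi> y))" if "continuous_on S \<phi>" for S \<phi>
    using continuous_on_lipschitz_comp[OF \<open>L \<ge> 0\<close> lip that] .
  have cont_T: "continuous_on {0..} (T \<phi>)" if "continuous_on {0..} \<phi>" for \<phi>
    unfolding T_def using that contF \<theta> \<open>a > 0\<close>
    by (intro continuous_intros continuous_on_volterra)
  have cont_W: "continuous_on {0..} (W k)" for k
  proof (induction k)
    case 0
    then show ?case by (simp add: W_def)
  next
    case (Suc k)
    then show ?case by (simp add: W_Suc cont_T)
  qed
  have T_lip: "\<bar>T \<phi> x - T \<psi> x\<bar> \<le> C * (L * B * x ^ Suc k / Suc k)"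
    if "x \<ge> 0" "continuous_on {0..} \<phi>" "continuous_on {0..} \<psi>"
      and "\<And>y. y \<in> {0..x} \<Longrightarrow> \<bar>\<phi> y - \<psi> y\<bar> \<le> B * y ^ k" for \<phi> \<psi> x B k
  proof -
    have "\<bar>T \<phi> x - T \<psi> x\<bar> =
        C * \<bar>volterra \<theta> a (\<lambda>z. F (\<phi> z)) x - volterra \<theta> a (\<lambda>z. F (\<psi> z)) x\<bar>"
      unfolding T_def by (rule abs_diff_affine[OF \<open>C \<ge> 0\<close>])
    also have "\<dots> \<le> C * (L * B * x ^ Suc k / Suc k)"
      using that lip \<theta> \<open>a > 0\<close> \<open>L \<ge> 0\<close> \<open>C \<ge> 0\<close>
      by (intro mult_left_mono volterra_lipschitz contF)
        (auto intro: continuous_on_subset[OF that(2)] continuous_on_subset[OF that(3)])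
    finally show ?thesis .
  qed
  \<comment> \<open>The first increment is at most \<open>G * x\<close>.\<close>
  define G where "G = C * \<bar>F P\<bar>"
  have step: "\<bar>W (Suc k) x - W k x\<bar> \<le> (G * (C * L) ^ k / fact (Suc k)) * x ^ Suc k"
    if "x \<ge> 0" for k x
    using that
  proof (induction k arbitrary: x)
    case 0
    have "\<bar>volterra \<theta> a (\<lambda>y. F P) x\<bar> \<le> \<bar>F P\<bar> * x ^ Suc 0 / Suc 0"
      using 0 \<theta> \<open>a > 0\<close> by (intro volterra_bound) auto
    then have "C * \<bar>volterra \<theta> a (\<lambda>y. F P) x\<bar> \<le> C * (\<bar>F P\<bar> * x ^ Suc 0 / Suc 0)"
      using \<open>C \<ge> 0\<close> by (rule mult_left_mono)
    then show ?case
      using \<open>C \<ge> 0\<close> by (simp add: W_def T_def G_def abs_mult mult.assoc)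
  next
    case (Suc k)
    have "\<bar>T (W (Suc k)) x - T (W k) x\<bar>
        \<le> C * (L * (G * (C * L) ^ k / fact (Suc k)) * x ^ Suc (Suc k) / Suc (Suc k))"
      using Suc by (intro T_lip cont_W) auto
    also have "\<dots> = (G * (C * L) ^ Suc k / fact (Suc (Suc k))) * x ^ Suc (Suc k)"
      by (simp add: divide_simps)
    finally show ?case by (simp add: W_Suc)
  qed
  have W_sum: "W k x = P + (\<Sum>i<k. W (Suc i) x - W i x)" for k x
    by (subst sum_lessThan_telescope) (simp add: W_def)
  define v where "v x = P + (\<Sum>i. W (Suc i) x - W i x)" for x
  have unif: "uniform_limit {0..X} W v sequentially" if "X \<ge> 0" for X
  proof -
    have "uniform_limit {0..X} (\<lambda>k x. \<Sum>i<k. W (Suc i) x - W i x)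
        (\<lambda>x. \<Sum>i. W (Suc i) x - W i x) sequentially"
    proof (rule Weierstrass_m_test)
      have "G \<ge> 0" using \<open>C \<ge> 0\<close> by (simp add: G_def)
      fix k x assume "x \<in> {0..X}"
      have "norm (W (Suc k) x - W k x) \<le> (G * (C * L) ^ k / fact (Suc k)) * x ^ Suc k"
        using step \<open>x \<in> {0..X}\<close> by simp
      \<comment> \<open>Replacing \<open>fact (Suc k)\<close> by the smaller \<open>fact k\<close>
        turns the bound into a multiple of the exponential series at
        \<open>C * L * X\<close>.\<close>
      also have "\<dots> \<le> (G * (C * L) ^ k / fact k) * X ^ Suc k"
        using \<open>x \<in> {0..X}\<close> \<open>G \<ge> 0\<close> \<open>C \<ge> 0\<close> \<open>L \<ge> 0\<close>
        by (intro mult_mono divide_left_mono power_mono) (auto simp: fact_mono)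
      also have "\<dots> = G * X * (inverse (fact k) * (C * L * X) ^ k)"
        by (simp add: power_mult_distrib divide_simps)
      finally show "norm (W (Suc k) x - W k x) \<le> G * X * (inverse (fact k) * (C * L * X) ^ k)" .
    next
      show "summable (\<lambda>k. G * X * (inverse (fact k) * (C * L * X) ^ k))"
        by (intro summable_mult summable_exp)
    qed
    from uniform_limit_add[OF uniform_limit_const[of "\<lambda>_. P" "{0..X}" sequentially] this]
    show ?thesis
      by (simp add: v_def[abs_def] W_sum[symmetric])
  qed
  have cont_v: "continuous_on {0..X} v" if "X \<ge> 0" for X
    using that by (intro uniform_limit_theorem[OF _ unif])
      (auto intro!: always_eventually intro: continuous_on_subset[OF cont_W])
  have cont: "continuous_on {0..} v"
  proof (rule continuous_on_ge_0I)
    fix x :: real assume "x > 0"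
    then show "isCont v x"
      using cont_v[of "x+1"] by (intro continuous_on_interior[of "{0..x+1}"]) auto
  next
    show "(v \<longlongrightarrow> v 0) (at_right 0)"
      using continuous_on_Icc_at_rightD[OF cont_v[OF zero_le_one] zero_less_one] .
  qed
  have "v x = T v x" if "x \<ge> 0" for x
  proof (rule LIMSEQ_unique)
    show "(\<lambda>k. W (Suc k) x) \<longlonglongrightarrow> v x"
      using tendsto_uniform_limitI[OF unif[OF that]] that by (intro LIMSEQ_Suc) auto
    show "(\<lambda>k. W (Suc k) x) \<longlonglongrightarrow> T v x"
    proof (rule LIMSEQ_I)
      fix e :: real assume "e > 0"
      \<comment> \<open>The \<open>+ 1\<close> keeps the denominator positive when
        \<open>C * L * x = 0\<close> and makes the final estimate strict.\<close>
      define d where "d = e / (C * L * x + 1)"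
      have pos: "C * L * x + 1 > 0"
        using \<open>C \<ge> 0\<close> \<open>L \<ge> 0\<close> that by (simp add: add_nonneg_pos)
      then have "d > 0" using \<open>e > 0\<close> by (simp add: d_def)
      from uniform_limitD[OF unif[OF that] this]
      obtain K where K: "\<And>k y. k \<ge> K \<Longrightarrow> y \<in> {0..x} \<Longrightarrow> \<bar>W k y - v y\<bar> < d"
        unfolding eventually_sequentially dist_real_def by blast
      have "norm (W (Suc k) x - T v x) < e" if "k \<ge> K" for k
      proof -
        have "\<bar>T (W k) x - T v x\<bar> \<le> C * (L * d * x ^ Suc 0 / Suc 0)"
          using K[OF that] \<open>x \<ge> 0\<close> by (intro T_lip cont_W cont) (auto intro: less_imp_le)
        also have "\<dots> < (C * L * x + 1) * d"
          using \<open>d > 0\<close> by (simp add: algebra_simps)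
        also have "\<dots> = e"
          using pos by (simp add: d_def)
        finally show ?thesis by (simp add: W_Suc)
      qed
      then show "\<exists>K. \<forall>k\<ge>K. norm (W (Suc k) x - T v x) < e" by blast
    qed
  qed
  with cont that show ?thesis by (simp add: T_def)
qed

section \<open>The profile system\<close>

lemma powr_lipschitz:
  fixes \<gamma> :: real
  assumes "\<gamma> > 1" "s \<in> {0..P}" "t \<in> {0..P}"
  shows "\<bar>t powr \<gamma> - s powr \<gamma>\<bar> \<le> \<gamma> * P powr (\<gamma> - 1) * \<bar>t - s\<bar>"
  using assms(2,3)
proof (induction s t rule: linorder_wlog)
  case (le s t)
  show ?case
  proof (cases "s = t")
    case False
    with le have "s < t" by simp
    have "\<exists>l z. s < z \<and> z < t \<and> DERIV (\<lambda>x. x powr \<gamma>) z :> l \<and>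
        t powr \<gamma> - s powr \<gamma> = (t - s) * l"
      using \<open>s < t\<close> le \<open>\<gamma> > 1\<close>
      by (intro MVT continuous_on_powr' continuous_intros)
        (auto simp: real_differentiable_def intro!: exI has_real_derivative_powr)
    then obtain l z where z: "s < z" "z < t" "DERIV (\<lambda>x. x powr \<gamma>) z :> l"
      and eq: "t powr \<gamma> - s powr \<gamma> = (t - s) * l" by blast
    have "z > 0" using z le by auto
    have "l = \<gamma> * z powr (\<gamma> - 1)"
      using z(3) has_real_derivative_powr[OF \<open>z > 0\<close>] DERIV_unique by blast
    moreover have "z powr (\<gamma> - 1) \<le> P powr (\<gamma> - 1)"
      using z le \<open>\<gamma> > 1\<close> by (intro powr_mono2) auto
    ultimately have "l \<le> \<gamma> * P powr (\<gamma> - 1)" "l \<ge> 0"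
      using \<open>\<gamma> > 1\<close> by auto
    then show ?thesis
      using eq \<open>s < t\<close> by (simp add: abs_mult mult.commute mult_right_mono)
  qed simp
qed (simp add: abs_minus_commute)

text \<open>Clamping to \<open>{0..P}\<close> does not increase distances, so the truncated power is
  Lipschitz on the whole line, as the Picard iteration demands.\<close>

lemma clamped_powr_lipschitz:
  fixes \<gamma> P :: real
  assumes "\<gamma> > 1" "P > 0"
  shows "\<bar>(max 0 (min x P)) powr \<gamma> - (max 0 (min y P)) powr \<gamma>\<bar> \<le> \<gamma> * P powr (\<gamma> - 1) * \<bar>x - y\<bar>"
proof -
  have "\<bar>max 0 (min x P) - max 0 (min y P)\<bar> \<le> \<bar>x - y\<bar>"
    by (auto simp: max_def min_def abs_if)
  with assms show ?thesis
    by (intro order_trans[OF powr_lipschitz[of \<gamma> _ P]] mult_left_mono) auto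
qed

text \<open>In the new time \<open>\<Phi>\<close> the equation reads
  \<open>dY / d\<Phi> = B - K * Y\<close>. With the integrating factor
  \<open>exp (K * \<Phi>)\<close>, l'Hospital's rule reduces the limit to that of
  \<open>B / K\<close>. Only the denominator has to diverge, which suits quantities whose
  boundedness is not known in advance.\<close>

lemma relaxation_limit:
  fixes Y \<Phi> \<omega> B :: "real \<Rightarrow> real"
  assumes "K > 0" and \<Phi>: "eventually (\<lambda>x. (\<Phi> has_real_derivative \<omega> x) (at x)) at_top"
    and \<Phi>_top: "filterlim \<Phi> at_top at_top" and pos: "eventually (\<lambda>x. \<omega> x > 0) at_top"
    and Y: "eventually (\<lambda>x. (Y has_real_derivative \<omega> x * (B x - K * Y x)) (at x)) at_top"
    and B: "(B \<longlongrightarrow> B0) at_top"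
  shows "(Y \<longlongrightarrow> B0 / K) at_top"
proof -
  have "((\<lambda>x. exp (K * \<Phi> x) * Y x / exp (K * \<Phi> x)) \<longlongrightarrow> B0 / K) at_top"
  proof (rule lhospital_at_top_at_top)
    show "filterlim (\<lambda>x. exp (K * \<Phi> x)) at_top at_top"
      by (intro filterlim_compose[OF exp_at_top] filterlim_tendsto_pos_mult_at_top[OF tendsto_const] \<open>K > 0\<close> \<Phi>_top)
    show "eventually (\<lambda>x. exp (K * \<Phi> x) * (K * \<omega> x) \<noteq> 0) at_top"
      using pos by eventually_elim (use \<open>K > 0\<close> in simp)
    show "eventually (\<lambda>x. ((\<lambda>x. exp (K * \<Phi> x)) has_real_derivative exp (K * \<Phi> x) * (K * \<omega> x)) (at x)) at_top"
      using \<Phi> by eventually_elim (auto intro!: derivative_eq_intros)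
    show "eventually (\<lambda>x. ((\<lambda>x. exp (K * \<Phi> x) * Y x) has_real_derivative
        exp (K * \<Phi> x) * (\<omega> x * B x)) (at x)) at_top"
      using \<Phi> Y by eventually_elim (auto intro!: derivative_eq_intros simp: algebra_simps)
    have "((\<lambda>x. B x / K) \<longlongrightarrow> B0 / K) at_top"
      using B \<open>K > 0\<close> by (intro tendsto_intros) auto
    moreover have "eventually (\<lambda>x. B x / K = exp (K * \<Phi> x) * (\<omega> x * B x) / (exp (K * \<Phi> x) * (K * \<omega> x))) at_top"
      using pos by eventually_elim (use \<open>K > 0\<close> in simp)
    ultimately show "((\<lambda>x. exp (K * \<Phi> x) * (\<omega> x * B x) / (exp (K * \<Phi> x) * (K * \<omega> x))) \<longlongrightarrow> B0 / K) at_top"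
      by (rule Lim_transform_eventually)
  qed
  then show ?thesis by simp
qed

text \<open>The formula for \<open>\<sigma>\<close> amounts to
  \<open>\<sigma> + 1 - \<theta> = \<gamma> * (1 - \<theta>)\<close>. This identity makes the
  right-hand side of the equation for \<open>p\<close> an exact derivative, which permits the
  reduction to a single integral equation.\<close>

locale profile_ode =
  fixes \<gamma> \<theta> \<sigma> K P :: real
  assumes gamma: "\<gamma> > 1" and theta: "0 < \<theta>" "\<theta> < 1" and K: "K > 0" and P: "P > 0"
    and sigma: "\<sigma> = (\<gamma> - 1) * (1 - \<theta>)"
begin

lemma sigma_pos: "\<sigma> > 0"
  using gamma theta by (simp add: sigma)

section \<open>The singular system and its integral form\<close>

definition solution :: "(real \<Rightarrow> real) \<Rightarrow> (real \<Rightarrow> real) \<Rightarrow> bool" where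
  "solution v p \<longleftrightarrow>
     (\<forall>x>0. v x > 0) \<and>
     (\<forall>x>0. (v has_real_derivative (p x - v x) / (\<sigma> * x)) (at x)) \<and>
     (\<forall>x>0. (p has_real_derivative - K * v x powr (\<gamma> - 1) * (p x - \<theta> * v x)) (at x)) \<and>
     (v \<longlongrightarrow> P) (at_right 0)"

text \<open>The value of \<open>p\<close> prescribed by a first integral of the system, with
  \<open>V\<close> in the role of \<open>v powr \<gamma>\<close>. Keeping \<open>V\<close> as an
  argument also allows a truncated power.\<close>

definition flux :: "(real \<Rightarrow> real) \<Rightarrow> real \<Rightarrow> real" where
  "flux V x = P - K / \<gamma> * ((1 - \<theta>) * integral {0..x} V + \<sigma> * x * V x)"

text \<open>With \<open>a = 1 / \<sigma>\<close> the function \<open>x powr (- a)\<close> solves the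
  homogeneous equation \<open>\<sigma> * x * v' = - v\<close>; the integral equation is the
  variation-of-constants formula for the first equation of the system with
  \<open>p = flux V\<close>. As \<open>V\<close> is an arbitrary continuous function, this is
  available before \<open>V\<close> is known to be the true power.\<close>

lemma has_derivative_fixpoint:
  assumes "continuous_on {0..} V" "x > 0"
    and fixp: "\<And>x. x \<ge> 0 \<Longrightarrow> v x = P - K / \<gamma> * volterra \<theta> (1 / \<sigma>) V x"
  shows "(v has_real_derivative (flux V x - v x) / (\<sigma> * x)) (at x)"
proof -
  define a where "a = 1 / \<sigma>"
  have "a > 0" using sigma_pos by (simp add: a_def)
  define I where "I x = integral {0..x} V" for x
  define J where "J x = integral {0..x} (\<lambda>y. y powr a * V y)" for x
  have I: "(I has_real_derivative V x) (at x)"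
    unfolding I_def using assms by (intro integral_has_field_derivative)
  have J: "(J has_real_derivative x powr a * V x) (at x)"
    unfolding J_def using assms \<open>a > 0\<close>
    by (intro integral_has_field_derivative continuous_on_mult continuous_on_powr' continuous_intros) auto
  have eq: "eventually (\<lambda>x. v x = P - K / \<gamma> * ((1 - \<theta>) * I x + \<theta> * (x powr (- a) * J x))) (nhds x)"
    using eventually_nhds_in_open[of "{0<..}" x] \<open>x > 0\<close>
    by (auto elim!: eventually_mono simp: fixp volterra_def I_def J_def a_def)
  have aa: "x powr - a * x powr a = 1" "x powr (- a - 1) = x powr - a / x"
    using \<open>x > 0\<close> by (simp_all add: powr_add[symmetric] powr_diff)
  have "((\<lambda>x. P - K / \<gamma> * ((1 - \<theta>) * I x + \<theta> * (x powr (- a) * J x))) has_real_derivative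
      0 - K / \<gamma> * ((1 - \<theta>) * V x + \<theta> * (x powr (- a) * (x powr a * V x) + (- a * x powr (- a - 1)) * J x))) (at x)"
    by (rule derivative_eq_intros I J has_real_derivative_powr \<open>x > 0\<close> refl | simp)+
  also have "0 - K / \<gamma> * ((1 - \<theta>) * V x + \<theta> * (x powr (- a) * (x powr a * V x) + (- a * x powr (- a - 1)) * J x))
      = - K / \<gamma> * (V x - a * \<theta> * (x powr - a * J x) / x)"
    unfolding mult.assoc[symmetric] aa by (simp add: algebra_simps)
  also have "\<dots> = (flux V x - v x) / (\<sigma> * x)"
    using sigma_pos \<open>x > 0\<close> gamma unfolding flux_def fixp[OF less_imp_le[OF \<open>x > 0\<close>]] volterra_def
      I_def[symmetric] J_def[symmetric] a_def[symmetric]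
    by (simp add: a_def field_simps)
  finally show ?thesis
    using DERIV_cong_ev[OF refl eq refl] by blast
qed

text \<open>Here \<open>V\<close> has to agree with the true power. Differentiating
  \<open>\<sigma> * x * V x\<close> cancels the singular factor \<open>1 / x\<close> of
  \<open>v'\<close>, and the formula for \<open>\<sigma>\<close> collects the rest into a multiple
  of \<open>p - \<theta> * v\<close>.\<close>

lemma has_derivative_flux:
  assumes "continuous_on {0..} V" "x > 0" "v x > 0"
    and V: "(V has_real_derivative \<gamma> * v x powr (\<gamma> - 1) * ((flux V x - v x) / (\<sigma> * x))) (at x)"
      "V x = v x powr \<gamma>"
  shows "(flux V has_real_derivative - K * v x powr (\<gamma> - 1) * (flux V x - \<theta> * v x)) (at x)"
proof -
  define p where "p = flux V x"
  have I: "((\<lambda>x. integral {0..x} V) has_real_derivative V x) (at x)"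
    using assms by (intro integral_has_field_derivative)
  have pw: "v x powr \<gamma> = v x powr (\<gamma> - 1) * v x"
    using \<open>v x > 0\<close> by (simp add: powr_diff)
  have "(flux V has_real_derivative - (K / \<gamma> * ((1 - \<theta>) * V x +
      (\<sigma> * V x + \<sigma> * x * (\<gamma> * v x powr (\<gamma> - 1) * ((p - v x) / (\<sigma> * x))))))) (at x)"
    unfolding flux_def[abs_def] p_def
    by (rule derivative_eq_intros I V(1)[unfolded flux_def] refl | simp add: flux_def)+
  also have "- (K / \<gamma> * ((1 - \<theta>) * V x + (\<sigma> * V x + \<sigma> * x * (\<gamma> * v x powr (\<gamma> - 1) * ((p - v x) / (\<sigma> * x))))))
      = - (K / \<gamma>) * v x powr (\<gamma> - 1) * ((1 - \<theta> + \<sigma>) * v x + \<gamma> * (p - v x))"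
  proof -
    have "\<sigma> * x * (\<gamma> * v x powr (\<gamma> - 1) * ((p - v x) / (\<sigma> * x))) = \<gamma> * v x powr (\<gamma> - 1) * (p - v x)"
      using \<open>x > 0\<close> sigma_pos by simp
    then show ?thesis
      unfolding V(2) pw by (simp only:) (simp add: algebra_simps add_divide_distrib diff_divide_distrib)
  qed
  also have "(1 - \<theta> + \<sigma>) * v x + \<gamma> * (p - v x) = \<gamma> * (p - \<theta> * v x)"
    by (simp add: sigma algebra_simps)
  also have "- (K / \<gamma>) * v x powr (\<gamma> - 1) * (\<gamma> * (p - \<theta> * v x)) = - K * v x powr (\<gamma> - 1) * (p - \<theta> * v x)"
    using gamma by simp
  finally show ?thesis by (simp add: p_def)
qed

text \<open>A solution is constrained only on the open half line; the value \<open>P\<close> at 0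
  lets integrals start at the singular point.\<close>

lemma extended_by_continuity:
  assumes "solution v p"
  shows "continuous_on {0..} (\<lambda>x. if x \<le> 0 then P else v x)"
proof (rule continuous_on_ge_0I)
  fix x :: real assume "x > 0"
  then have "isCont v x"
    using assms DERIV_isCont unfolding solution_def by blast
  moreover have "eventually (\<lambda>x. v x = (if x \<le> 0 then P else v x)) (nhds x)"
    using eventually_nhds_in_open[of "{0<..}" x] \<open>x > 0\<close> by (auto elim!: eventually_mono)
  ultimately show "isCont (\<lambda>x. if x \<le> 0 then P else v x) x"
    by (rule isCont_cong[THEN iffD1, rotated])
next
  have "(v \<longlongrightarrow> P) (at_right 0)"
    using assms by (simp add: solution_def)
  moreover have "eventually (\<lambda>x. v x = (if x \<le> 0 then P else v x)) (at_right 0)"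
    using eventually_at_right_less[of 0] by eventually_elim auto
  ultimately show "((\<lambda>x. if x \<le> 0 then P else v x) \<longlongrightarrow> (if (0::real) \<le> 0 then P else v 0)) (at_right 0)"
    using Lim_transform_eventually by fastforce
qed

text \<open>The system has two conserved quantities: a first integral tying \<open>p\<close> to
  \<open>v\<close>, and the quantity \<open>R\<close> from variation of constants. Boundedness of
  \<open>v\<close> near 0 excludes the homogeneous solution \<open>x powr (- a)\<close> and fixes
  the constant of \<open>R\<close>; the limit \<open>P\<close> then fixes the other constant
  \<open>E0\<close>.\<close>

lemma solution_fixpoint:
  assumes sol: "solution v p" and "x > 0"
  defines "w \<equiv> \<lambda>x. if x \<le> 0 then P else v x"
  shows "v x = P - K / \<gamma> * volterra \<theta> (1 / \<sigma>) (\<lambda>x. w x powr \<gamma>) x"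
proof -
  define a where "a = 1 / \<sigma>"
  have "a > 0" and a\<sigma>: "a * \<sigma> = 1" using sigma_pos by (simp_all add: a_def)
  have cont_w: "continuous_on {0..} w"
    unfolding w_def by (rule extended_by_continuity[OF sol])
  have v_pos: "v x > 0" if "x > 0" for x using sol that by (simp add: solution_def)
  have v: "(v has_real_derivative (p x - v x) / (\<sigma> * x)) (at x)" if "x > 0" for x
    using sol that by (simp add: solution_def)
  have p: "(p has_real_derivative - K * v x powr (\<gamma> - 1) * (p x - \<theta> * v x)) (at x)" if "x > 0" for x
    using sol that by (simp add: solution_def)
  define V where "V x = w x powr \<gamma>" for x
  have V_eq: "V x = v x powr (\<gamma> - 1) * v x" if "x > 0" for x
    using that v_pos[OF that] by (simp add: V_def w_def powr_diff)
  have cont_V: "continuous_on {0..} V"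
    unfolding V_def using cont_w gamma
    by (intro continuous_on_powr' continuous_intros) (auto simp: w_def P less_imp_le v_pos)
  have dV: "(V has_real_derivative \<gamma> * v x powr (\<gamma> - 1) * ((p x - v x) / (\<sigma> * x))) (at x)"
    if "x > 0" for x
  proof -
    have "((\<lambda>x. v x powr \<gamma>) has_real_derivative \<gamma> * v x powr (\<gamma> - 1) * ((p x - v x) / (\<sigma> * x))) (at x)"
      using DERIV_fun_powr[OF v[OF that] v_pos[OF that], of \<gamma>] by (simp add: mult_ac)
    moreover have "eventually (\<lambda>x. V x = v x powr \<gamma>) (nhds x)"
      using eventually_nhds_in_open[of "{0<..}" x] that
      by (auto elim!: eventually_mono simp: V_def w_def)
    ultimately show ?thesis by (rule DERIV_cong_ev[OF refl _ refl, THEN iffD2, rotated])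
  qed
  define I where "I x = integral {0..x} V" for x
  define J where "J x = integral {0..x} (\<lambda>y. y powr a * V y)" for x
  have I: "(I has_real_derivative V x) (at x)" if "x > 0" for x
    unfolding I_def using cont_V that by (intro integral_has_field_derivative)
  have J: "(J has_real_derivative x powr a * V x) (at x)" if "x > 0" for x
    unfolding J_def using cont_V \<open>a > 0\<close> that
    by (intro integral_has_field_derivative continuous_on_mult continuous_on_powr' continuous_intros) auto

  have "\<exists>E0. \<forall>x\<in>{0<..}. p x + K / \<gamma> * (\<sigma> * x * V x + (1 - \<theta>) * I x) = E0"
  proof (rule has_field_derivative_zero_constant)
    fix x :: real assume "x \<in> {0<..}"
    then have "x > 0" by simp
    let ?dV = "\<gamma> * v x powr (\<gamma> - 1) * ((p x - v x) / (\<sigma> * x))"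
    have deriv: "((\<lambda>x. p x + K / \<gamma> * (\<sigma> * x * V x + (1 - \<theta>) * I x)) has_real_derivative
       - K * v x powr (\<gamma> - 1) * (p x - \<theta> * v x) + K / \<gamma> * (\<sigma> * V x + \<sigma> * x * ?dV + (1 - \<theta>) * V x)) (at x)"
      by (rule derivative_eq_intros I p dV \<open>x > 0\<close> refl | simp)+
    have 1: "\<sigma> * x * ?dV = \<gamma> * v x powr (\<gamma> - 1) * (p x - v x)"
      using \<open>x > 0\<close> sigma_pos by simp
    have 2: "\<sigma> + 1 - \<theta> = \<gamma> * (1 - \<theta>)"
      by (simp add: sigma algebra_simps)
    have "\<sigma> * V x + \<sigma> * x * ?dV + (1 - \<theta>) * V x
        = v x powr (\<gamma> - 1) * ((\<sigma> + 1 - \<theta>) * v x + \<gamma> * (p x - v x))"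
      unfolding 1 V_eq[OF \<open>x > 0\<close>] by (simp add: algebra_simps)
    also have "\<dots> = \<gamma> * (v x powr (\<gamma> - 1) * (p x - \<theta> * v x))"
      unfolding 2 by (simp add: algebra_simps)
    finally have 3: "\<sigma> * V x + \<sigma> * x * ?dV + (1 - \<theta>) * V x
        = \<gamma> * (v x powr (\<gamma> - 1) * (p x - \<theta> * v x))" .
    show "((\<lambda>x. p x + K / \<gamma> * (\<sigma> * x * V x + (1 - \<theta>) * I x)) has_real_derivative 0) (at x within {0<..})"
      by (rule has_field_derivative_at_within) (use deriv[unfolded 3] gamma in simp)
  qed simp
  then obtain E0 where "\<forall>x\<in>{0<..}. p x + K / \<gamma> * (\<sigma> * x * V x + (1 - \<theta>) * I x) = E0" ..
  then have E0: "p x = E0 - K / \<gamma> * (\<sigma> * x * V x + (1 - \<theta>) * I x)" if "x > 0" for x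
    using that by (simp only: eq_diff_eq greaterThan_iff Ball_def)

  \<comment> \<open>This is \<open>x powr a\<close> times the defect in the integral equation with
    \<open>E0\<close> in place of \<open>P\<close>.\<close>
  define R where "R x = x powr a * (v x - E0) + K / \<gamma> * ((1 - \<theta>) * (x powr a * I x) + \<theta> * J x)" for x
  have "\<exists>c. \<forall>x\<in>{0<..}. R x = c"
  proof (rule has_field_derivative_zero_constant)
    fix x :: real assume "x \<in> {0<..}"
    then have "x > 0" by simp
    have pw: "x powr (a - 1) = x powr a / x"
      using \<open>x > 0\<close> by (simp add: powr_diff)
    have deriv: "(R has_real_derivative
       a * x powr (a - 1) * (v x - E0) + x powr a * ((p x - v x) / (\<sigma> * x)) +
       K / \<gamma> * ((1 - \<theta>) * (a * x powr (a - 1) * I x + x powr a * V x) + \<theta> * (x powr a * V x))) (at x)"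
      unfolding R_def[abs_def]
      by (rule derivative_eq_intros I J v has_real_derivative_powr \<open>x > 0\<close> refl)+ (simp add: mult_ac)
    have 1: "(p x - v x) / (\<sigma> * x) = a * (p x - v x) / x"
      by (simp add: a_def)
    have "a * x powr (a - 1) * (v x - E0) + x powr a * ((p x - v x) / (\<sigma> * x)) +
       K / \<gamma> * ((1 - \<theta>) * (a * x powr (a - 1) * I x + x powr a * V x) + \<theta> * (x powr a * V x))
      = x powr a / x * (a * (p x - E0 + K / \<gamma> * (1 - \<theta>) * I x)) + x powr a * (K / \<gamma> * V x)"
      unfolding pw 1 by (simp add: algebra_simps add_divide_distrib diff_divide_distrib)
    also have "a * (p x - E0 + K / \<gamma> * (1 - \<theta>) * I x) = - (K / \<gamma> * V x * x)"
    proof -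
      have "p x - E0 + K / \<gamma> * (1 - \<theta>) * I x = - (K / \<gamma> * V x * x) * \<sigma>"
        unfolding E0[OF \<open>x > 0\<close>] by (simp add: algebra_simps add_divide_distrib diff_divide_distrib)
      then show ?thesis using a\<sigma> by simp
    qed
    also have "x powr a / x * - (K / \<gamma> * V x * x) + x powr a * (K / \<gamma> * V x) = 0"
      using \<open>x > 0\<close> by simp
    finally have "(R has_real_derivative 0) (at x)"
      using deriv by (rule subst)
    then show "(R has_real_derivative 0) (at x within {0<..})"
      by (rule has_field_derivative_at_within)
  qed simp
  then obtain c where c: "\<And>x. x > 0 \<Longrightarrow> R x = c" by auto
  have lims: "(v \<longlongrightarrow> P) (at_right 0)" "(I \<longlongrightarrow> 0) (at_right 0)" "(J \<longlongrightarrow> 0) (at_right 0)"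
    "((\<lambda>x. x powr a) \<longlongrightarrow> 0) (at_right 0)"
  proof -
    show "(v \<longlongrightarrow> P) (at_right 0)" using sol by (simp add: solution_def)
    have lim0: "((\<lambda>x. integral {0..x} f) \<longlongrightarrow> 0) (at_right 0)"
      if "continuous_on {0..} f" for f :: "real \<Rightarrow> real"
    proof -
      have "continuous_on {0..1} (\<lambda>x. integral {0..x} f)"
        using that by (intro indefinite_integral_continuous_1 integrable_continuous_interval)
          (auto intro: continuous_on_subset)
      then show ?thesis using continuous_on_Icc_at_rightD[of 0 1] by fastforce
    qed
    show "(I \<longlongrightarrow> 0) (at_right 0)" unfolding I_def by (rule lim0[OF cont_V])
    show "(J \<longlongrightarrow> 0) (at_right 0)" unfolding J_def using \<open>a > 0\<close> cont_V
      by (intro lim0 continuous_on_mult continuous_on_powr' continuous_intros) auto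
    have "((\<lambda>x. x powr a) \<longlongrightarrow> 0 powr a) (at_right 0)"
      using \<open>a > 0\<close> by (intro tendsto_powr' tendsto_intros) (auto simp: eventually_at_right_less intro: eventually_at_right_less eventually_mono)
    then show "((\<lambda>x. x powr a) \<longlongrightarrow> 0) (at_right 0)" by simp
  qed
  \<comment> \<open>All terms vanish at 0 because \<open>v\<close> stays bounded; a multiple of
    \<open>x powr (- a)\<close> in \<open>v\<close> would have left a nonzero constant.\<close>
  have "(R \<longlongrightarrow> 0 * (P - E0) + K / \<gamma> * ((1 - \<theta>) * (0 * 0) + \<theta> * 0)) (at_right 0)"
    unfolding R_def[abs_def] by (intro tendsto_intros lims)
  moreover have "eventually (\<lambda>x. R x = c) (at_right 0)"
    using eventually_at_right_less[of 0] by eventually_elim (rule c)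
  ultimately have "((\<lambda>_::real. c) \<longlongrightarrow> 0) (at_right 0)"
    using Lim_transform_eventually by fastforce
  then have "c = 0"
    by (simp add: tendsto_const_iff)
  have v_eq: "v x = E0 - K / \<gamma> * volterra \<theta> a V x" if "x > 0" for x
  proof -
    have "x powr (- a) * R x = 0" using c[OF that] \<open>c = 0\<close> by simp
    moreover have "x powr (- a) * R x = (x powr (- a) * x powr a) * (v x - E0 + K / \<gamma> * ((1 - \<theta>) * I x))
        + K / \<gamma> * (\<theta> * (x powr (- a) * J x))"
      by (simp add: R_def algebra_simps)
    moreover have "x powr (- a) * x powr a = 1"
      using that by (simp add: powr_add[symmetric])
    ultimately have "v x - E0 + K / \<gamma> * ((1 - \<theta>) * I x) + K / \<gamma> * (\<theta> * (x powr (- a) * J x)) = 0"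
      by simp
    moreover have "volterra \<theta> a V x = (1 - \<theta>) * I x + \<theta> * (x powr (- a) * J x)"
      by (simp add: volterra_def I_def J_def)
    ultimately show ?thesis
      by (simp only: distrib_left)
  qed
  have "(volterra \<theta> a V \<longlongrightarrow> volterra \<theta> a V 0) (at_right 0)"
    using continuous_on_Icc_at_rightD[of 0 1] continuous_on_volterra[OF _ _ \<open>a > 0\<close> cont_V] theta
    by (metis atLeastatMost_subset_iff continuous_on_subset less_imp_le zero_less_one Icc_subset_Ici_iff order_refl)
  then have "(volterra \<theta> a V \<longlongrightarrow> 0) (at_right 0)"
    by (simp add: volterra_def)
  then have "((\<lambda>x. E0 - K / \<gamma> * volterra \<theta> a V x) \<longlongrightarrow> E0 - K / \<gamma> * 0) (at_right 0)"
    by (intro tendsto_intros)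
  moreover have "eventually (\<lambda>x. E0 - K / \<gamma> * volterra \<theta> a V x = v x) (at_right 0)"
    using eventually_at_right_less[of 0] by eventually_elim (simp add: v_eq)
  ultimately have "(v \<longlongrightarrow> E0) (at_right 0)"
    using Lim_transform_eventually by fastforce
  then have "E0 = P"
    using lims(1) tendsto_unique[of "at_right (0::real)"] by simp
  moreover have "(\<lambda>x. w x powr \<gamma>) = V"
    by (simp add: V_def fun_eq_iff)
  ultimately show ?thesis
    using v_eq[OF \<open>x > 0\<close>] by (simp only: a_def)
qed

section \<open>Uniqueness and global existence from the singular point\<close>

lemma solution_unique:
  assumes "solution v1 p1" "solution v2 p2" "x > 0"
  shows "v1 x = v2 x"
proof -
  define w where "w v x = (if x \<le> 0 then P else v x)" for v :: "real \<Rightarrow> real" and x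
  have w: "continuous_on {0..} (w v)" "\<And>y. w v y > 0" "continuous_on {0..} (\<lambda>y. w v y powr \<gamma>)"
    "\<And>y. y \<ge> 0 \<Longrightarrow> w v y = P - K / \<gamma> * volterra \<theta> (1 / \<sigma>) (\<lambda>z. w v z powr \<gamma>) y"
    "\<And>y. y \<ge> 0 \<Longrightarrow> w v y \<le> P"
    if "solution v p" for v p
  proof -
    show c: "continuous_on {0..} (w v)"
      using extended_by_continuity[OF that] by (simp add: w_def[abs_def])
    show pos: "w v y > 0" for y
      using that P by (auto simp: w_def solution_def)
    show c': "continuous_on {0..} (\<lambda>y. w v y powr \<gamma>)"
      using c pos by (intro continuous_on_powr' continuous_intros) (auto intro: less_imp_le simp: less_imp_neq[symmetric])
    show eq: "w v y = P - K / \<gamma> * volterra \<theta> (1 / \<sigma>) (\<lambda>z. w v z powr \<gamma>) y" if "y \<ge> 0" for y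
    proof (cases "y = 0")
      case True
      then show ?thesis by (simp add: w_def volterra_def)
    next
      case False
      with that show ?thesis
        using solution_fixpoint[OF \<open>solution v p\<close>, of y] by (simp add: w_def[abs_def])
    qed
    \<comment> \<open>Nonnegativity of the operator gives the a priori bound \<open>P\<close>, and
      on \<open>{0..P}\<close> the power is Lipschitz.\<close>
    have "volterra \<theta> (1 / \<sigma>) (\<lambda>z. w v z powr \<gamma>) y \<ge> 0" if "y \<ge> 0" for y
      using theta sigma_pos by (intro volterra_nonneg continuous_on_subset[OF c']) auto
    then show "w v y \<le> P" if "y \<ge> 0" for y
      using eq[OF that] that K gamma by simp
  qed
  have "w v1 x = w v2 x"
  proof (rule volterra_fixpoint_unique[where x = x and \<phi> = "w v1" and \<psi> = "w v2" and F = "\<lambda>x. x powr \<gamma>" and \<theta> = \<theta> and a = "1 / \<sigma>"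
        and C = "K / \<gamma>" and L = "\<gamma> * P powr (\<gamma> - 1)" and P = P])
    show "\<bar>w v1 y powr \<gamma> - w v2 y powr \<gamma>\<bar> \<le> \<gamma> * P powr (\<gamma> - 1) * \<bar>w v1 y - w v2 y\<bar>"
      if "y \<in> {0..x}" for y
      using that gamma w(2,5)[OF assms(1)] w(2,5)[OF assms(2)]
      by (intro powr_lipschitz) (auto intro: less_imp_le)
  qed (use assms w[OF assms(1)] w[OF assms(2)] theta sigma_pos gamma K in
        \<open>auto intro: continuous_on_subset\<close>)
  then show ?thesis using assms(3) by (simp add: w_def)
qed

text \<open>The iteration solves the clamped problem on the whole half line. Nonnegativity of the
  operator keeps \<open>v\<close> below \<open>P\<close>; \<open>v > 0\<close> and
  \<open>p > \<theta> * v\<close> are then proved together by a first-exit argument, after which the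
  clamped and the true power coincide along \<open>v\<close>.\<close>

lemma solution_exists:
  obtains v p where "solution v p" "\<And>x. x > 0 \<Longrightarrow> \<theta> * v x < p x" "\<And>x. x > 0 \<Longrightarrow> p x \<le> v x"
proof -
  define a where "a = 1 / \<sigma>"
  have "a > 0" using sigma_pos by (simp add: a_def)
  define F where "F x = (max 0 (min x P)) powr \<gamma>" for x
  have lip: "\<bar>F x - F y\<bar> \<le> \<gamma> * P powr (\<gamma> - 1) * \<bar>x - y\<bar>" for x y
    unfolding F_def by (rule clamped_powr_lipschitz[OF gamma P])
  have L: "\<gamma> * P powr (\<gamma> - 1) \<ge> 0" using gamma by simp
  have C: "K / \<gamma> > 0" using gamma K by simp
  obtain v where cont_v: "continuous_on {0..} v"
    and fixp: "\<And>x. x \<ge> 0 \<Longrightarrow> v x = P - K / \<gamma> * volterra \<theta> (1 / \<sigma>) (\<lambda>y. F (v y)) x"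
    using volterra_fixpoint_exists[of \<theta> "1 / \<sigma>" "K / \<gamma>" "\<gamma> * P powr (\<gamma> - 1)" F P]
      theta \<open>a > 0\<close> C L lip unfolding a_def by (metis less_imp_le)
  define V where "V y = F (v y)" for y
  define p where "p = flux V"
  have "(\<lambda>y. F (v y)) = V" by (simp add: V_def fun_eq_iff)
  note fixpV = fixp[unfolded this]
  have cont_V: "continuous_on {0..} V"
    unfolding V_def by (rule continuous_on_lipschitz_comp[OF L lip cont_v])
  have v_le: "v x \<le> P" if "x \<ge> 0" for x
  proof -
    have "volterra \<theta> (1 / \<sigma>) V x \<ge> 0"
      using theta \<open>a > 0\<close>
      by (intro volterra_nonneg continuous_on_subset[OF cont_V]) (auto simp: V_def F_def a_def)
    then have "K / \<gamma> * volterra \<theta> (1 / \<sigma>) V x \<ge> 0"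
      using C by (intro mult_nonneg_nonneg) auto
    then show ?thesis using fixpV[OF that] by simp
  qed
  have v0: "v 0 = P" using fixp[of 0] by (simp add: volterra_def)
  have dv: "(v has_real_derivative (p x - v x) / (\<sigma> * x)) (at x)" if "x > 0" for x
    unfolding p_def by (rule has_derivative_fixpoint[OF cont_V that]) (rule fixpV)
  have dp: "(p has_real_derivative - K * v x powr (\<gamma> - 1) * (p x - \<theta> * v x)) (at x)"
    if "x > 0" "v x > 0" for x
    unfolding p_def
  proof (rule has_derivative_flux[where v = v, OF cont_V that])
    show "V x = v x powr \<gamma>" using v_le[of x] that by (simp add: V_def F_def)
    have "isCont v x" using dv[OF that(1)] by (rule DERIV_isCont)
    then have "eventually (\<lambda>y. v y > 0) (nhds x)"
      unfolding isCont_def tendsto_at_iff_tendsto_nhds using that(2) by (rule order_tendstoD(1))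
    moreover have "eventually (\<lambda>y. y \<in> {0<..}) (nhds x)"
      using \<open>x > 0\<close> by (intro eventually_nhds_in_open) auto
    ultimately have "eventually (\<lambda>y. V y = v y powr \<gamma>) (nhds x)"
      by eventually_elim (use v_le in \<open>force simp: V_def F_def\<close>)
    moreover have "((\<lambda>x. v x powr \<gamma>) has_real_derivative \<gamma> * v x powr (\<gamma> - 1) * ((p x - v x) / (\<sigma> * x))) (at x)"
      using DERIV_fun_powr[OF dv[OF that(1)] that(2), of \<gamma>] by (simp add: mult_ac)
    ultimately show "(V has_real_derivative \<gamma> * v x powr (\<gamma> - 1) * ((flux V x - v x) / (\<sigma> * x))) (at x)"
      unfolding p_def by (rule DERIV_cong_ev[OF refl _ refl, THEN iffD2])
  qed
  have cont_p: "continuous_on {0..} p"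
  proof -
    have "continuous_on {0..} (\<lambda>x. integral {0..x} V)"
    proof (rule continuous_on_ge_0I)
      show "isCont (\<lambda>x. integral {0..x} V) x" if "x > 0" for x
        using integral_has_field_derivative[OF cont_V that] by (rule DERIV_isCont)
      have "continuous_on {0..1} (\<lambda>x. integral {0..x} V)"
        by (intro indefinite_integral_continuous_1 integrable_continuous_interval
            continuous_on_subset[OF cont_V]) auto
      then show "((\<lambda>x. integral {0..x} V) \<longlongrightarrow> integral {0..0} V) (at_right 0)"
        using continuous_on_Icc_at_rightD[of 0 1] by fastforce
    qed
    then show ?thesis
      unfolding p_def flux_def[abs_def] using cont_V by (intro continuous_intros)
  qed
  have p0: "p 0 = P" by (simp add: p_def flux_def)
  define h where "h x = p x - \<theta> * v x" for x
  have cont_h: "continuous_on {0..} h"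
    unfolding h_def using cont_p cont_v by (intro continuous_intros)
  have pos: "v x > 0 \<and> h x > 0" if "x \<ge> 0" for x
  proof (rule ccontr)
    assume neg: "\<not> (v x > 0 \<and> h x > 0)"
    \<comment> \<open>Taking the minimum puts both possible failures into one closed set, so its
      infimum is the first bad point.\<close>
    define S where "S = {x\<in>{0..}. min (v x) (h x) \<le> 0}"
    have "closed S"
      unfolding S_def using cont_v cont_h
      by (intro continuous_on_closed_Collect_le continuous_intros) auto
    have "x \<in> S" using neg that by (auto simp: S_def)
    have "bdd_below S" by (auto simp: S_def bdd_below_def)
    define z where "z = Inf S"
    have "z \<in> S"
      unfolding z_def using \<open>x \<in> S\<close> \<open>bdd_below S\<close> \<open>closed S\<close> by (intro closed_contains_Inf) auto
    have "0 \<notin> S"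
      using P theta by (simp add: S_def v0 h_def p0 algebra_simps)
    then have "z > 0" using \<open>z \<in> S\<close> by (cases "z = 0") (auto simp: S_def)
    have below: "v y > 0" "h y > 0" if "0 \<le> y" "y < z" for y
    proof -
      have "y \<notin> S" using that cInf_lower[OF _ \<open>bdd_below S\<close>] unfolding z_def by force
      then show "v y > 0" "h y > 0" using that by (auto simp: S_def)
    qed
    \<comment> \<open>With this exponent \<open>v y * y powr b\<close> has derivative
      \<open>y powr b * a / y * h y\<close>. Positivity of \<open>h\<close> before \<open>z\<close>
      therefore keeps \<open>v\<close> from vanishing at \<open>z\<close>.\<close>
    define b where "b = a * (1 - \<theta>)"
    have "v (z / 2) * (z / 2) powr b \<le> v z * z powr b"
    proof (rule DERIV_nonneg_imp_increasing_open[where f = "\<lambda>y. v y * y powr b"])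
      fix y assume y: "z / 2 < y" "y < z"
      then have "y > 0" using \<open>z > 0\<close> by simp
      have "((\<lambda>y. v y * y powr b) has_real_derivative
          (p y - v y) / (\<sigma> * y) * y powr b + (b * y powr (b - 1)) * v y) (at y)"
        by (rule DERIV_mult dv has_real_derivative_powr \<open>y > 0\<close>)+
      also have "(p y - v y) / (\<sigma> * y) * y powr b + (b * y powr (b - 1)) * v y = y powr b * a / y * h y"
      proof -
        have 1: "(p y - v y) / (\<sigma> * y) = a * (p y - v y) / y" "y powr (b - 1) = y powr b / y"
          using \<open>y > 0\<close> by (simp_all add: a_def powr_diff)
        show ?thesis
          unfolding 1 h_def by (simp add: b_def algebra_simps add_divide_distrib diff_divide_distrib)
      qed
      finally show "\<exists>d. ((\<lambda>y. v y * y powr b) has_real_derivative d) (at y) \<and> 0 \<le> d"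
        using below[of y] y \<open>y > 0\<close> \<open>a > 0\<close> by (intro exI conjI) auto
    next
      show "continuous_on {z / 2..z} (\<lambda>y. v y * y powr b)"
        using \<open>z > 0\<close> by (intro continuous_intros continuous_on_subset[OF cont_v]) auto
    qed (use \<open>z > 0\<close> in auto)
    moreover have "v (z / 2) * (z / 2) powr b > 0"
      using below[of "z / 2"] \<open>z > 0\<close> by simp
    ultimately have "v z * z powr b > 0" by linarith
    then have "v z > 0" by (simp add: zero_less_mult_iff)
    then have "h z \<le> 0" using \<open>z \<in> S\<close> by (auto simp: S_def)
    \<comment> \<open>It is thus \<open>h\<close> that fails at \<open>z\<close>. There
      \<open>p < v\<close>, and both parts of this derivative push \<open>h\<close> upwards, so
      \<open>h\<close> would already be negative just before \<open>z\<close>.\<close>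
    have dh: "(h has_real_derivative - K * v z powr (\<gamma> - 1) * h z - \<theta> * ((p z - v z) / (\<sigma> * z))) (at z)"
      unfolding h_def[abs_def]
      by (rule derivative_eq_intros dv dp \<open>z > 0\<close> \<open>v z > 0\<close> refl | simp)+
    have "p z - v z = h z - (1 - \<theta>) * v z" by (simp add: h_def algebra_simps)
    also have "\<dots> < 0" using \<open>h z \<le> 0\<close> mult_pos_pos[of "1 - \<theta>" "v z"] \<open>v z > 0\<close> theta by linarith
    finally have "(p z - v z) / (\<sigma> * z) < 0"
      using \<open>z > 0\<close> sigma_pos by (simp add: divide_neg_pos)
    then have "\<theta> * ((p z - v z) / (\<sigma> * z)) < 0"
      using theta(1) by (intro mult_pos_neg)
    moreover have "- K * v z powr (\<gamma> - 1) * h z \<ge> 0"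
      using K \<open>h z \<le> 0\<close> by (simp add: mult_nonneg_nonpos)
    ultimately have "- K * v z powr (\<gamma> - 1) * h z - \<theta> * ((p z - v z) / (\<sigma> * z)) > 0"
      by linarith
    from DERIV_pos_inc_left[OF dh this]
    obtain d where d: "d > 0" "\<And>e. e > 0 \<Longrightarrow> e < d \<Longrightarrow> h (z - e) < h z" by blast
    define e where "e = min d z / 2"
    have "e > 0" "e < d" "e < z" using \<open>d > 0\<close> \<open>z > 0\<close> by (auto simp: e_def)
    then have "h (z - e) < h z" "h (z - e) > 0" using d(2) below[of "z - e"] by auto
    then show False using \<open>h z \<le> 0\<close> by simp
  qed
  have "p x \<le> v x" if "x > 0" for x
  proof -
    \<comment> \<open>The weight \<open>y powr a\<close> absorbs the singular term of
      \<open>v'\<close>. The weighted difference starts at 0 and its derivative is a nonnegative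
      multiple of \<open>h\<close>.\<close>
    have "0 powr a * (v 0 - p 0) \<le> x powr a * (v x - p x)"
    proof (rule DERIV_nonneg_imp_increasing_open[where f = "\<lambda>y. y powr a * (v y - p y)"])
      fix y assume y: "0 < y" "y < x"
      then have vy: "v y > 0" "h y > 0" using pos[of y] by auto
      have "((\<lambda>y. y powr a * (v y - p y)) has_real_derivative
          (a * y powr (a - 1)) * (v y - p y) +
          ((p y - v y) / (\<sigma> * y) - - K * v y powr (\<gamma> - 1) * (p y - \<theta> * v y)) * y powr a) (at y)"
        by (rule DERIV_mult DERIV_diff dv dp has_real_derivative_powr \<open>0 < y\<close> vy)+
      also have "(a * y powr (a - 1)) * (v y - p y) +
          ((p y - v y) / (\<sigma> * y) - - K * v y powr (\<gamma> - 1) * (p y - \<theta> * v y)) * y powr a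
          = y powr a * (K * v y powr (\<gamma> - 1) * h y)"
      proof -
        have 1: "(p y - v y) / (\<sigma> * y) = a * (p y - v y) / y" "y powr (a - 1) = y powr a / y"
          using \<open>0 < y\<close> by (simp_all add: a_def powr_diff)
        show ?thesis
          unfolding 1 h_def by (simp add: algebra_simps add_divide_distrib diff_divide_distrib)
      qed
      finally show "\<exists>d. ((\<lambda>y. y powr a * (v y - p y)) has_real_derivative d) (at y) \<and> 0 \<le> d"
        using vy K by (intro exI conjI) auto
    next
      show "continuous_on {0..x} (\<lambda>y. y powr a * (v y - p y))"
        using \<open>a > 0\<close>
        by (intro continuous_intros continuous_on_powr' continuous_on_subset[OF cont_v] continuous_on_subset[OF cont_p]) auto
    qed (use that in auto)
    then show ?thesis using that by (simp add: zero_le_mult_iff)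
  qed
  moreover have "solution v p"
    unfolding solution_def
  proof (intro conjI allI impI)
    have "(v \<longlongrightarrow> v 0) (at_right 0)"
      using continuous_on_subset[OF cont_v, of "{0..1}"] continuous_on_Icc_at_rightD[of 0 1 v] by fastforce
    then show "(v \<longlongrightarrow> P) (at_right 0)" by (simp add: v0)
  qed (use pos dv dp in \<open>auto intro: less_imp_le\<close>)
  moreover have "\<theta> * v x < p x" if "x > 0" for x
    using pos[of x] that by (simp add: h_def)
  ultimately show ?thesis
    using that by blast
qed

section \<open>Logarithmic growth of \<open>x * v x powr (\<gamma> - 1)\<close> at infinity\<close>

lemma solution_log_growth:
  assumes sol: "solution v p"
    and lower: "\<And>x. x > 0 \<Longrightarrow> \<theta> * v x < p x" and upper: "\<And>x. x > 0 \<Longrightarrow> p x \<le> v x"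
  shows "((\<lambda>x. x * v x powr (\<gamma> - 1) / ln x) \<longlongrightarrow> \<theta> / (\<sigma> * K)) at_top"
proof -
  have v_pos: "v x > 0" if "x > 0" for x using sol that by (simp add: solution_def)
  have dv: "(v has_real_derivative (p x - v x) / (\<sigma> * x)) (at x)" if "x > 0" for x
    using sol that by (simp add: solution_def)
  have dp: "(p has_real_derivative - K * v x powr (\<gamma> - 1) * (p x - \<theta> * v x)) (at x)" if "x > 0" for x
    using sol that by (simp add: solution_def)
  define \<omega> where "\<omega> x = v x powr (\<gamma> - 1)" for x
  define w where "w x = x * \<omega> x" for x
  define \<rho> where "\<rho> x = p x / v x" for x
  define \<eta> where "\<eta> x = \<rho> x - \<theta>" for x
  have \<omega>_pos: "\<omega> x > 0" if "x > 0" for x using v_pos[OF that] by (simp add: \<omega>_def)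
  have w_pos: "w x > 0" if "x > 0" for x using \<omega>_pos[OF that] that by (simp add: w_def)
  have \<rho>: "\<theta> < \<rho> x" "\<rho> x \<le> 1" if "x > 0" for x
    using v_pos[OF that] lower[OF that] upper[OF that] by (simp_all add: \<rho>_def field_simps)
  have \<eta>: "0 < \<eta> x" "\<eta> x \<le> 1 - \<theta>" if "x > 0" for x
    using \<rho>[OF that] by (simp_all add: \<eta>_def)
  have d\<eta>: "(\<eta> has_real_derivative (\<rho> x * (1 - \<rho> x)) / (\<sigma> * x) - K * \<omega> x * \<eta> x) (at x)"
    if "x > 0" for x
  proof -
    have "v x \<noteq> 0" using v_pos[OF that] by simp
    have "(\<eta> has_real_derivative
        ((- K * v x powr (\<gamma> - 1) * (p x - \<theta> * v x)) * v x - p x * ((p x - v x) / (\<sigma> * x))) / (v x * v x) - 0) (at x)"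
      unfolding \<eta>_def[abs_def] \<rho>_def[abs_def]
      by (intro DERIV_diff DERIV_divide dv dp that \<open>v x \<noteq> 0\<close> DERIV_const)
    moreover have "((- K * v x powr (\<gamma> - 1) * (p x - \<theta> * v x)) * v x - p x * ((p x - v x) / (\<sigma> * x))) / (v x * v x) - 0
        = (\<rho> x * (1 - \<rho> x)) / (\<sigma> * x) - K * \<omega> x * \<eta> x"
    proof -
      have "p x = \<rho> x * v x" using \<open>v x \<noteq> 0\<close> by (simp add: \<rho>_def)
      then show ?thesis
        using \<open>v x \<noteq> 0\<close> unfolding \<omega>_def[symmetric] \<eta>_def
        by (simp add: divide_simps) (simp add: algebra_simps)
    qed
    ultimately show ?thesis by simp
  qed
  \<comment> \<open>By the formula for \<open>\<sigma>\<close>, the growth of the factor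
    \<open>x\<close> and the decay of \<open>\<omega>\<close> combine to \<open>1 + (\<rho> x - 1) /
    (1 - \<theta>) = \<eta> x / (1 - \<theta>)\<close>.\<close>
  have dw: "(w has_real_derivative \<omega> x * \<eta> x / (1 - \<theta>)) (at x)" if "x > 0" for x
  proof -
    have "v x \<noteq> 0" using v_pos[OF that] by simp
    have d\<omega>: "(\<omega> has_real_derivative (\<gamma> - 1) * v x powr (\<gamma> - 1 - 1) * ((p x - v x) / (\<sigma> * x))) (at x)"
      unfolding \<omega>_def[abs_def] using DERIV_fun_powr[OF dv[OF that] v_pos[OF that], of "\<gamma> - 1"] by (simp add: mult_ac)
    have "(w has_real_derivative 1 * \<omega> x + (\<gamma> - 1) * v x powr (\<gamma> - 1 - 1) * ((p x - v x) / (\<sigma> * x)) * x) (at x)"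
      unfolding w_def[abs_def] by (intro DERIV_mult DERIV_ident d\<omega>)
    moreover have "1 * \<omega> x + (\<gamma> - 1) * v x powr (\<gamma> - 1 - 1) * ((p x - v x) / (\<sigma> * x)) * x
        = \<omega> x * \<eta> x / (1 - \<theta>)"
    proof -
      have 1: "p x = \<rho> x * v x" using \<open>v x \<noteq> 0\<close> by (simp add: \<rho>_def)
      have 2: "v x powr (\<gamma> - 1 - 1) = \<omega> x / v x"
        unfolding \<omega>_def powr_diff[of _ "\<gamma> - 1" 1] using v_pos[OF that] by simp
      show ?thesis
        unfolding 1 2 \<eta>_def sigma using \<open>v x \<noteq> 0\<close> that gamma theta
        by (simp add: divide_simps) (simp add: algebra_simps)
    qed
    ultimately show ?thesis by simp
  qed
  have w_mono: "w x \<le> w y" if "0 < x" "x \<le> y" for x y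
  proof (rule DERIV_nonneg_imp_nondecreasing[OF that(2)])
    fix z assume "x \<le> z" "z \<le> y"
    then have "z > 0" using that by simp
    then show "\<exists>d. (w has_real_derivative d) (at z) \<and> 0 \<le> d"
      using dw \<omega>_pos[of z] \<eta>[of z] theta by (intro exI conjI) auto
  qed
  have unbounded: "\<exists>x\<ge>1. w x > W" for W
  proof (rule ccontr)
    assume "\<not> (\<exists>x\<ge>1. w x > W)"
    then have le: "w x \<le> W" if "x \<ge> 1" for x using that by force
    have "W > 0" using le[of 1] w_pos[of 1] by simp
    \<comment> \<open>If \<open>w\<close> stayed below \<open>W\<close>, the growth of
      \<open>M * ln w\<close> would outweigh the terms \<open>- \<theta> * \<eta> / \<sigma>\<close>
      and \<open>- K * w * \<eta>\<close> in \<open>x * \<eta>'\<close>, while \<open>d\<close> is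
      the constant term of \<open>\<rho> * (1 - \<rho>) / \<sigma>\<close> expanded in
      \<open>\<eta>\<close>. Then \<open>\<eta> + M * ln w - d * ln x\<close> would be
      nondecreasing, although its first two terms are bounded above.\<close>
    define M where "M = (\<theta> / \<sigma> + K * W) * (1 - \<theta>)"
    define d where "d = \<theta> * (1 - \<theta>) / \<sigma>"
    have "d > 0" "M > 0"
      using theta sigma_pos K \<open>W > 0\<close> by (auto simp: d_def M_def intro!: mult_pos_pos add_pos_pos divide_pos_pos)
    define f where "f x = \<eta> x + M * ln (w x) - d * ln x" for x
    have f: "f 1 \<le> f x" if "x \<ge> 1" for x
    proof (rule DERIV_nonneg_imp_nondecreasing[OF that])
      fix z :: real assume "1 \<le> z" "z \<le> x"
      then have "z > 0" by simp
      have "(f has_real_derivative ((\<rho> z * (1 - \<rho> z)) / (\<sigma> * z) - K * \<omega> z * \<eta> z)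
          + M * (1 / w z * (\<omega> z * \<eta> z / (1 - \<theta>))) - d * (1 / z)) (at z)"
        unfolding f_def[abs_def]
        by (intro DERIV_diff DERIV_add DERIV_cmult d\<eta> \<open>z > 0\<close> DERIV_ln_divide
            DERIV_chain2[OF DERIV_ln_divide[OF w_pos[OF \<open>z > 0\<close>]] dw[OF \<open>z > 0\<close>]])
      moreover have "((\<rho> z * (1 - \<rho> z)) / (\<sigma> * z) - K * \<omega> z * \<eta> z)
          + M * (1 / w z * (\<omega> z * \<eta> z / (1 - \<theta>))) - d * (1 / z)
          = (\<eta> z * (1 - \<theta> - \<eta> z) / \<sigma> + K * (W - w z) * \<eta> z) / z"
      proof -
        have 1: "\<omega> z = w z / z" using \<open>z > 0\<close> by (simp add: w_def)
        have 2: "M * (1 / w z * (w z / z * \<eta> z / (1 - \<theta>))) = (\<theta> / \<sigma> + K * W) * \<eta> z / z"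
          using w_pos[OF \<open>z > 0\<close>] theta by (simp add: M_def)
        have 3: "\<rho> z = \<eta> z + \<theta>" by (simp add: \<eta>_def)
        show ?thesis
          unfolding 1 2 d_def 3 by (simp add: algebra_simps add_divide_distrib diff_divide_distrib)
      qed
      moreover have "(\<eta> z * (1 - \<theta> - \<eta> z) / \<sigma> + K * (W - w z) * \<eta> z) / z \<ge> 0"
        using \<open>z > 0\<close> sigma_pos K \<eta>[of z] le[OF \<open>1 \<le> z\<close>]
        by (intro divide_nonneg_pos add_nonneg_nonneg mult_nonneg_nonneg) auto
      ultimately show "\<exists>D. (f has_real_derivative D) (at z) \<and> 0 \<le> D"
        by (intro exI conjI) auto
    qed
    define C where "C = 1 + M * ln W - f 1"
    have "d * ln x \<le> C" if "x \<ge> 1" for x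
    proof -
      have "M * ln (w x) \<le> M * ln W"
        using \<open>M > 0\<close> le[OF that] w_pos[of x] \<open>W > 0\<close> that by (intro mult_left_mono) auto
      moreover have "\<eta> x \<le> 1" using \<eta>[of x] that theta by simp
      ultimately show ?thesis
        using f[OF that] by (simp add: f_def C_def)
    qed
    \<comment> \<open>At this point \<open>d * ln x\<close> equals \<open>\<bar>C\<bar> + 1\<close>,
      which exceeds \<open>C\<close>.\<close>
    from this[of "exp ((\<bar>C\<bar> + 1) / d)"] show False
      using \<open>d > 0\<close> by simp
  qed
  have w_top: "filterlim w at_top at_top"
    unfolding filterlim_at_top
  proof
    fix W
    obtain x where x: "x \<ge> 1" "w x > W" using unbounded by blast
    show "eventually (\<lambda>y. W \<le> w y) at_top"
      using eventually_ge_at_top[of x] by eventually_elim (use x w_mono[of x] in force)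
  qed

  define V where "V x = (if x \<le> 0 then P else v x) powr (\<gamma> - 1)" for x
  have cont_V: "continuous_on {0..} V"
    unfolding V_def using extended_by_continuity[OF sol] gamma
    by (intro continuous_on_powr' continuous_intros) (auto simp: P less_imp_le v_pos)
  define \<Phi> where "\<Phi> x = integral {0..x} V" for x
  have d\<Phi>: "(\<Phi> has_real_derivative \<omega> x) (at x)" if "x > 0" for x
    using integral_has_field_derivative[OF cont_V that] that by (simp add: \<Phi>_def[abs_def] V_def \<omega>_def)
  \<comment> \<open>Beyond \<open>X\<close> one has \<open>w \<ge> 1\<close>, hence
    \<open>\<omega> \<ge> 1 / x\<close>, so \<open>\<Phi>\<close> grows at least like
    \<open>ln\<close>. This is the divergence that relaxation needs.\<close>
  obtain X where X: "X \<ge> 1" "w X > 1" using unbounded by blast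
  have "\<Phi> X - ln X + ln x \<le> \<Phi> x" if "x \<ge> X" for x
  proof -
    have "\<Phi> X - ln X \<le> \<Phi> x - ln x"
    proof (rule DERIV_nonneg_imp_nondecreasing[OF that, where f = "\<lambda>x. \<Phi> x - ln x"])
      fix z assume z: "X \<le> z" "z \<le> x"
      then have "z > 0" using X by simp
      have "w z \<ge> 1" using w_mono[of X z] X z by simp
      then have "\<omega> z - 1 / z \<ge> 0" using \<open>z > 0\<close> by (simp add: w_def field_simps)
      moreover have "((\<lambda>x. \<Phi> x - ln x) has_real_derivative \<omega> z - 1 / z) (at z)"
        by (intro DERIV_diff d\<Phi> DERIV_ln_divide \<open>z > 0\<close>)
      ultimately show "\<exists>D. ((\<lambda>x. \<Phi> x - ln x) has_real_derivative D) (at z) \<and> 0 \<le> D" by blast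
    qed
    then show ?thesis by simp
  qed
  then have "eventually (\<lambda>x. \<Phi> X - ln X + ln x \<le> \<Phi> x) at_top"
    by (rule eventually_mono[OF eventually_ge_at_top])
  moreover have "filterlim (\<lambda>x. \<Phi> X - ln X + ln x) at_top at_top"
    by (intro filterlim_tendsto_add_at_top[OF tendsto_const] ln_at_top)
  ultimately have \<Phi>_top: "filterlim \<Phi> at_top at_top"
    using filterlim_at_top_mono by blast
  have gt0: "eventually (\<lambda>x::real. x > 0) at_top" by (rule eventually_gt_at_top)
  have \<Phi>': "eventually (\<lambda>x. (\<Phi> has_real_derivative \<omega> x) (at x)) at_top"
    using gt0 by eventually_elim (rule d\<Phi>)
  have \<omega>': "eventually (\<lambda>x. \<omega> x > 0) at_top"
    using gt0 by eventually_elim (rule \<omega>_pos)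

  \<comment> \<open>Relative to the rate \<open>\<omega>\<close> the source in the equation for
    \<open>\<eta>\<close> is \<open>\<rho> * (1 - \<rho>) / (\<sigma> * w)\<close>, which dies out
    because \<open>w\<close> is unbounded.\<close>
  have "(\<eta> \<longlongrightarrow> 0 / K) at_top"
  proof (rule relaxation_limit[OF K \<Phi>' \<Phi>_top \<omega>'])
    show "eventually (\<lambda>x. (\<eta> has_real_derivative \<omega> x * (\<rho> x * (1 - \<rho> x) / (\<sigma> * w x) - K * \<eta> x)) (at x)) at_top"
      using gt0
    proof eventually_elim
      case (elim x)
      have "\<omega> x * (\<rho> x * (1 - \<rho> x) / (\<sigma> * w x) - K * \<eta> x) = (\<rho> x * (1 - \<rho> x)) / (\<sigma> * x) - K * \<omega> x * \<eta> x"
        using \<omega>_pos[OF elim] elim sigma_pos by (simp add: w_def field_simps)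
      then show ?case using d\<eta>[OF elim] by simp
    qed
    have "filterlim (\<lambda>x. \<sigma> * w x) at_top at_top"
      by (rule filterlim_tendsto_pos_mult_at_top[OF tendsto_const sigma_pos w_top])
    then have "((\<lambda>x. 1 / (\<sigma> * w x)) \<longlongrightarrow> 0) at_top"
      by (rule real_tendsto_divide_at_top[OF tendsto_const])
    moreover have "eventually (\<lambda>x. norm (\<rho> x * (1 - \<rho> x) / (\<sigma> * w x)) \<le> 1 / (\<sigma> * w x)) at_top"
      using gt0
    proof eventually_elim
      case (elim x)
      have "0 \<le> \<rho> x" "\<rho> x \<le> 1" using \<rho>[OF elim] theta by auto
      then have "0 \<le> \<rho> x * (1 - \<rho> x)" "\<rho> x * (1 - \<rho> x) \<le> 1 * 1"
        using mult_mono[of "\<rho> x" 1 "1 - \<rho> x" 1] by auto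
      then show ?case
        using w_pos[OF elim] sigma_pos by (simp add: divide_right_mono abs_mult)
    qed
    ultimately show "((\<lambda>x. \<rho> x * (1 - \<rho> x) / (\<sigma> * w x)) \<longlongrightarrow> 0) at_top"
      by (rule Lim_null_comparison[rotated])
  qed
  then have \<eta>_lim: "(\<eta> \<longlongrightarrow> 0) at_top" by simp
  then have "((\<lambda>x. \<eta> x + \<theta>) \<longlongrightarrow> 0 + \<theta>) at_top" by (intro tendsto_intros)
  then have \<rho>_lim: "(\<rho> \<longlongrightarrow> \<theta>) at_top" by (simp add: \<eta>_def)

  \<comment> \<open>Multiplication by \<open>w\<close> removes the decaying factor from the source,
    which now tends to \<open>\<theta> * (1 - \<theta>) / \<sigma>\<close>; the new term
    \<open>\<eta>\<^sup>2 / (1 - \<theta>)\<close> from \<open>w'\<close> vanishes in the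
    limit.\<close>
  have Q_lim: "((\<lambda>x. w x * \<eta> x) \<longlongrightarrow> (0\<^sup>2 / (1 - \<theta>) + \<theta> * (1 - \<theta>) / \<sigma>) / K) at_top"
  proof (rule relaxation_limit[OF K \<Phi>' \<Phi>_top \<omega>'])
    show "((\<lambda>x. (\<eta> x)\<^sup>2 / (1 - \<theta>) + \<rho> x * (1 - \<rho> x) / \<sigma>) \<longlongrightarrow> 0\<^sup>2 / (1 - \<theta>) + \<theta> * (1 - \<theta>) / \<sigma>) at_top"
      using theta sigma_pos by (intro tendsto_intros \<eta>_lim \<rho>_lim) auto
    show "eventually (\<lambda>x. ((\<lambda>x. w x * \<eta> x) has_real_derivative
        \<omega> x * ((\<eta> x)\<^sup>2 / (1 - \<theta>) + \<rho> x * (1 - \<rho> x) / \<sigma> - K * (w x * \<eta> x))) (at x)) at_top"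
      using gt0
    proof eventually_elim
      case (elim x)
      have "((\<lambda>x. w x * \<eta> x) has_real_derivative \<omega> x * \<eta> x / (1 - \<theta>) * \<eta> x +
          ((\<rho> x * (1 - \<rho> x)) / (\<sigma> * x) - K * \<omega> x * \<eta> x) * w x) (at x)"
        by (intro DERIV_mult dw d\<eta> elim)
      moreover have "\<omega> x * \<eta> x / (1 - \<theta>) * \<eta> x + ((\<rho> x * (1 - \<rho> x)) / (\<sigma> * x) - K * \<omega> x * \<eta> x) * w x
          = \<omega> x * ((\<eta> x)\<^sup>2 / (1 - \<theta>) + \<rho> x * (1 - \<rho> x) / \<sigma> - K * (w x * \<eta> x))"
      proof -
        have "(\<rho> x * (1 - \<rho> x)) / (\<sigma> * x) * w x = \<omega> x * (\<rho> x * (1 - \<rho> x) / \<sigma>)"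
          using elim by (simp add: w_def)
        then show ?thesis by (simp add: left_diff_distrib right_diff_distrib distrib_left power2_eq_square)
      qed
      ultimately show ?case by simp
    qed
  qed
  \<comment> \<open>By l'Hospital's rule the limit is that of
    \<open>x * w' = w * \<eta> / (1 - \<theta>)\<close>.\<close>
  have "((\<lambda>x. w x / ln x) \<longlongrightarrow> \<theta> / (\<sigma> * K)) at_top"
  proof (rule lhospital_at_top_at_top[OF ln_at_top])
    show "eventually (\<lambda>x::real. 1 / x \<noteq> 0) at_top"
      using gt0 by eventually_elim simp
    show "eventually (\<lambda>x::real. (ln has_real_derivative 1 / x) (at x)) at_top"
      using gt0 by eventually_elim (rule DERIV_ln_divide)
    show "eventually (\<lambda>x. (w has_real_derivative \<omega> x * \<eta> x / (1 - \<theta>)) (at x)) at_top"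
      using gt0 by eventually_elim (rule dw)
    have "((\<lambda>x. w x * \<eta> x / (1 - \<theta>)) \<longlongrightarrow> (0\<^sup>2 / (1 - \<theta>) + \<theta> * (1 - \<theta>) / \<sigma>) / K / (1 - \<theta>)) at_top"
      using theta by (intro tendsto_divide Q_lim tendsto_const) auto
    also have "(0\<^sup>2 / (1 - \<theta>) + \<theta> * (1 - \<theta>) / \<sigma>) / K / (1 - \<theta>) = \<theta> / (\<sigma> * K)"
      using theta by simp
    finally show "((\<lambda>x. \<omega> x * \<eta> x / (1 - \<theta>) / (1 / x)) \<longlongrightarrow> \<theta> / (\<sigma> * K)) at_top"
      by (simp add: w_def mult_ac)
  qed
  then show ?thesis by (simp add: w_def \<omega>_def)
qed

end

section \<open>Radial solutions\<close>

lemma deriv_deriv_on_greaterThan: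
  fixes f f' f'' :: "real \<Rightarrow> real"
  assumes f: "\<And>x. x > a \<Longrightarrow> (f has_real_derivative f' x) (at x)"
    and f': "\<And>x. x > a \<Longrightarrow> (f' has_real_derivative f'' x) (at x)" and "x > a"
  shows "deriv f x = f' x" "(deriv f has_real_derivative f'' x) (at x)" "deriv (deriv f) x = f'' x"
proof -
  have eq: "deriv f y = f' y" if "y > a" for y
    using f[OF that] by (rule DERIV_imp_deriv)
  then show "deriv f x = f' x" using \<open>x > a\<close> .
  have "eventually (\<lambda>y. deriv f y = f' y) (nhds x)"
    using eventually_nhds_in_open[of "{a<..}" x] \<open>x > a\<close> by (auto elim!: eventually_mono simp: eq)
  then show "(deriv f has_real_derivative f'' x) (at x)"
    using f'[OF \<open>x > a\<close>] by (rule DERIV_cong_ev[OF refl _ refl, THEN iffD2])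
  then show "deriv (deriv f) x = f'' x" by (rule DERIV_imp_deriv)
qed

text \<open>The condition \<open>m < (n - 2) / n\<close> enters as \<open>\<theta> < 1\<close>. The
  constant \<open>K\<close> is what the factor \<open>(n - 1) / m\<close> and the change of
  variables leave in front of the nonlinearity.\<close>

locale radial_profile = profile_ode \<gamma> \<theta> \<sigma> K P
  for \<gamma> \<theta> \<sigma> K P :: real +
  fixes n :: nat and m \<alpha> \<beta> A N :: real
  assumes n: "n \<ge> 3" and N: "N = real n - 2" and m: "0 < m" "m < 1" and \<beta>: "\<beta> < 0"
    and \<alpha>: "\<alpha> = 2 * \<beta> / (1 - m)" and A: "A > 0" and \<gamma>: "\<gamma> = 1 / m"
    and \<theta>: "\<theta> = 2 * m / ((1 - m) * N)" and K_eq: "K = - \<beta> / ((N + 1) * N * \<sigma>)"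
    and P_eq: "P = A powr m"
begin

lemma N_pos: "N > 0" using n by (simp add: N)

lemma m_gamma: "m * \<gamma> = 1" using m by (simp add: \<gamma>)

lemma alpha_eq: "\<alpha> = \<beta> * \<gamma> * N * \<theta>"
  using m N_pos by (simp add: \<alpha> \<gamma> \<theta>)

text \<open>With \<open>t = r powr (- N)\<close> this says that
  \<open>r\<^sup>2 * t powr (\<gamma> - 1)\<close> is
  \<open>r powr (- (N * \<sigma>))\<close>.\<close>

lemma N_sigma: "N * (\<gamma> - 1) = N * \<sigma> + 2"
proof -
  have "(\<gamma> - 1) * \<theta> * N = 2"
    using m N_pos by (simp add: \<gamma> \<theta> field_simps)
  then show ?thesis by (simp add: sigma algebra_simps)
qed

lemma K_mult: "K * N * N * \<sigma> * (N + 1) = - \<beta> * N"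
  using N_pos sigma_pos by (simp add: K_eq)

text \<open>For \<open>\<tau> = r powr (- N \<sigma>)\<close> the profile variables of a radial function \<open>u = f powr m\<close> are
  \<open>v \<tau> = r powr N * u r\<close> and \<open>p \<tau> = - r powr (N + 1) * u' r / N\<close>.\<close>

lemma scaled_powr:
  assumes "r > 0" "x > 0"
  shows "(r powr (- N) * x) powr (\<gamma> - 1) = r powr (- 2) * r powr (- (N * \<sigma>)) * x powr (\<gamma> - 1)"
proof -
  have "(r powr (- N)) powr (\<gamma> - 1) = r powr (- 2 + - (N * \<sigma>))"
    using N_sigma by (simp add: powr_powr algebra_simps)
  then show ?thesis
    using assms by (simp add: powr_mult powr_add[symmetric])
qed

text \<open>For \<open>u = r powr (- N) * x\<close>, \<open>u' = - N * r powr (- N - 1) * y\<close>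
  and \<open>f = u powr \<gamma>\<close>, the left-hand side is
  \<open>\<alpha> * f + \<beta> * r * f'\<close>. Since \<open>\<beta> < 0\<close>, its sign is that
  of \<open>y - \<theta> * x\<close>.\<close>

lemma drift_identity:
  assumes "r > 0" "x > 0"
  shows "\<alpha> * (r powr (- N) * x) powr \<gamma>
      + \<beta> * r * (\<gamma> * (r powr (- N) * x) powr (\<gamma> - 1) * (- N * r powr (- N - 1) * y))
    = - \<beta> * \<gamma> * N * r powr (- N - 2) * r powr (- (N * \<sigma>)) * x powr (\<gamma> - 1) * (y - \<theta> * x)"
proof -
  have 1: "(r powr (- N) * x) powr \<gamma> = (r powr (- N) * x) powr (\<gamma> - 1) * (r powr (- N) * x)"
    using assms by (simp add: powr_diff)
  have 2: "r * r powr (- N - 1) = r powr (- N)"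
    using assms by (simp add: powr_diff)
  have 3: "r powr (- N - 2) = r powr (- N) * r powr (- 2)"
    by (simp add: powr_add[symmetric])
  have "\<alpha> * (r powr (- N) * x) powr \<gamma>
      + \<beta> * r * (\<gamma> * (r powr (- N) * x) powr (\<gamma> - 1) * (- N * r powr (- N - 1) * y))
      = \<alpha> * (r powr (- N) * x) powr \<gamma>
      + \<beta> * \<gamma> * (r powr (- N) * x) powr (\<gamma> - 1) * (- N * (r * r powr (- N - 1)) * y)"
    by (simp add: mult_ac)
  also have "\<dots> = - \<beta> * \<gamma> * N * (r powr (- N) * r powr (- 2)) * r powr (- (N * \<sigma>)) * x powr (\<gamma> - 1) * (y - \<theta> * x)"
    unfolding 1 2 scaled_powr[OF assms] alpha_eq by (simp add: algebra_simps)
  finally show ?thesis unfolding 3 .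
qed

lemma has_derivative_scale:
  assumes "r > 0"
  shows "((\<lambda>r. r powr c) has_real_derivative c * r powr c / r) (at r)"
  using has_real_derivative_powr[OF assms, of c] assms by (simp add: powr_diff)

section \<open>Correspondence between profiles and radial solutions\<close>

lemma radial_solution_of_profile:
  assumes sol: "solution v p"
  defines "f \<equiv> \<lambda>r. (r powr (- N) * v (r powr (- (N * \<sigma>)))) powr \<gamma>"
  shows "radial_solution n m \<alpha> \<beta> f"
    and "((\<lambda>r. r powr ((real n - 2) / m) * f r) \<longlongrightarrow> A) at_top"
    and "\<And>r. r > 0 \<Longrightarrow> \<alpha> * f r + \<beta> * r * deriv f r =
      - \<beta> * \<gamma> * N * r powr (- N - 2) * r powr (- (N * \<sigma>)) * v (r powr (- (N * \<sigma>))) powr (\<gamma> - 1)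
        * (p (r powr (- (N * \<sigma>))) - \<theta> * v (r powr (- (N * \<sigma>))))"
proof -
  define T where "T r = r powr (- (N * \<sigma>))" for r :: real
  have T_pos: "T r > 0" if "r > 0" for r using that by (simp add: T_def)
  have v_pos: "v x > 0" if "x > 0" for x using sol that by (simp add: solution_def)
  have dv: "(v has_real_derivative (p x - v x) / (\<sigma> * x)) (at x)" if "x > 0" for x
    using sol that by (simp add: solution_def)
  have dp: "(p has_real_derivative - K * v x powr (\<gamma> - 1) * (p x - \<theta> * v x)) (at x)" if "x > 0" for x
    using sol that by (simp add: solution_def)
  have dT: "(T has_real_derivative - (N * \<sigma>) * T r / r) (at r)" if "r > 0" for r
    unfolding T_def[abs_def] by (rule has_derivative_scale[OF that])
  define u where "u r = r powr (- N) * v (T r)" for r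
  define u1 where "u1 r = - N * r powr (- N - 1) * p (T r)" for r
  define u2 where "u2 r = - N * ((- N - 1) * r powr (- N - 1) / r) * p (T r)
      + - N * r powr (- N - 1) * ((- K * v (T r) powr (\<gamma> - 1) * (p (T r) - \<theta> * v (T r))) * (- (N * \<sigma>) * T r / r))" for r
  have u_pos: "u r > 0" if "r > 0" for r
    using v_pos[OF T_pos[OF that]] that by (simp add: u_def)
  have dvT: "((\<lambda>r. v (T r)) has_real_derivative (p (T r) - v (T r)) / (\<sigma> * T r) * (- (N * \<sigma>) * T r / r)) (at r)"
    if "r > 0" for r
    by (rule DERIV_chain2[OF dv[OF T_pos[OF that]] dT[OF that]])
  have dpT: "((\<lambda>r. p (T r)) has_real_derivative (- K * v (T r) powr (\<gamma> - 1) * (p (T r) - \<theta> * v (T r))) * (- (N * \<sigma>) * T r / r)) (at r)"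
    if "r > 0" for r
    by (rule DERIV_chain2[OF dp[OF T_pos[OF that]] dT[OF that]])
  have du: "(u has_real_derivative u1 r) (at r)" if "r > 0" for r
  proof -
    have "(u has_real_derivative - N * r powr (- N) / r * v (T r)
        + (p (T r) - v (T r)) / (\<sigma> * T r) * (- (N * \<sigma>) * T r / r) * r powr (- N)) (at r)"
      unfolding u_def[abs_def] by (intro DERIV_mult has_derivative_scale dvT that)
    also have "(p (T r) - v (T r)) / (\<sigma> * T r) * (- (N * \<sigma>) * T r / r) = - N * (p (T r) - v (T r)) / r"
      using T_pos[OF that] sigma_pos by simp
    \<comment> \<open>The contributions of \<open>v\<close> cancel, so \<open>p\<close> is the
      rescaled radial derivative of \<open>u\<close>.\<close>
    also have "- N * r powr (- N) / r * v (T r) + - N * (p (T r) - v (T r)) / r * r powr (- N) = u1 r"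
      using that by (simp add: u1_def powr_diff divide_simps) (simp add: algebra_simps)
    finally show ?thesis .
  qed
  have du1: "(u1 has_real_derivative u2 r) (at r)" if "r > 0" for r
  proof -
    have "(u1 has_real_derivative - N * ((- N - 1) * r powr (- N - 1) / r) * p (T r)
      + ((- K * v (T r) powr (\<gamma> - 1) * (p (T r) - \<theta> * v (T r))) * (- (N * \<sigma>) * T r / r)) * (- N * r powr (- N - 1))) (at r)"
      unfolding u1_def[abs_def] by (intro DERIV_mult DERIV_cmult has_derivative_scale dpT that)
    then show ?thesis by (simp only: u2_def mult.commute)
  qed
  have f_u: "f r = u r powr \<gamma>" for r by (simp add: f_def u_def T_def)
  have f_pos: "f r > 0" if "r > 0" for r using u_pos[OF that] by (simp add: f_u)
  define f1 where "f1 r = \<gamma> * u r powr (\<gamma> - 1) * u1 r" for r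
  define f2 where "f2 r = \<gamma> * ((\<gamma> - 1) * u r powr (\<gamma> - 1 - 1) * u1 r) * u1 r + u2 r * (\<gamma> * u r powr (\<gamma> - 1))" for r
  have du_powr: "((\<lambda>r. u r powr c) has_real_derivative c * u r powr (c - 1) * u1 r) (at r)" if "r > 0" for r c
    using DERIV_fun_powr[OF du[OF that] u_pos[OF that], of c] by (simp add: mult_ac)
  have df: "(f has_real_derivative f1 r) (at r)" if "r > 0" for r
    using du_powr[OF that] unfolding f_u[abs_def] f1_def .
  have df1: "(f1 has_real_derivative f2 r) (at r)" if "r > 0" for r
    unfolding f1_def[abs_def] f2_def by (intro DERIV_mult DERIV_cmult du_powr du1 that)
  have f_derivs: "deriv f r = f1 r" "(deriv f has_real_derivative f2 r) (at r)" "deriv (deriv f) r = f2 r"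
    if "r > 0" for r
    using deriv_deriv_on_greaterThan[of 0 f f1 f2 r] df df1 that by auto
  have cont: "continuous_on {0<..} u" "continuous_on {0<..} u1" "continuous_on {0<..} (\<lambda>r. v (T r))"
      "continuous_on {0<..} (\<lambda>r. p (T r))" "continuous_on {0<..} T"
    using du du1 dvT dpT dT by (auto intro!: continuous_at_imp_continuous_on DERIV_isCont)
  have cont_u2: "continuous_on {0<..} u2"
    unfolding u2_def[abs_def]
    by (intro continuous_intros cont) (use v_pos T_pos in \<open>auto simp: less_imp_neq[symmetric]\<close>)
  have cont_f2: "continuous_on {0<..} f2"
    unfolding f2_def[abs_def]
    by (intro continuous_intros cont cont_u2) (use u_pos in \<open>auto simp: less_imp_neq[symmetric]\<close>)
  have "C2_on {0<..} f"
    unfolding C2_on_def field_differentiable_def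
  proof (intro conjI ballI)
    show "continuous_on {0<..} (deriv (deriv f))"
      using cont_f2 by (subst continuous_on_cong[OF refl f_derivs(3)]) auto
  qed (use df f_derivs(2) in auto)
  have drift: "\<alpha> * f r + \<beta> * r * f1 r =
      - \<beta> * \<gamma> * N * r powr (- N - 2) * T r * v (T r) powr (\<gamma> - 1) * (p (T r) - \<theta> * v (T r))" if "r > 0" for r
    using drift_identity[OF that v_pos[OF T_pos[OF that]], of "p (T r)"]
    by (simp only: f_u f1_def u_def u1_def T_def)
  show "\<And>r. r > 0 \<Longrightarrow> \<alpha> * f r + \<beta> * r * deriv f r =
      - \<beta> * \<gamma> * N * r powr (- N - 2) * r powr (- (N * \<sigma>)) * v (r powr (- (N * \<sigma>))) powr (\<gamma> - 1)
        * (p (r powr (- (N * \<sigma>))) - \<theta> * v (r powr (- (N * \<sigma>))))"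
    using drift f_derivs(1) by (simp only: T_def)
  show "radial_solution n m \<alpha> \<beta> f"
    unfolding radial_solution_def
  proof (intro conjI allI impI)
    fix r :: real assume "r > 0"
    have fm: "f s powr m = u s" if "s > 0" for s
      using u_pos[OF that] m_gamma by (simp add: f_u powr_powr mult.commute)
    have dfm: "((\<lambda>s. f s powr m) has_real_derivative u1 s) (at s)" if "s > 0" for s
    proof -
      have "eventually (\<lambda>s. f s powr m = u s) (nhds s)"
        using eventually_nhds_in_open[of "{0<..}" s] that by (auto elim!: eventually_mono simp: fm)
      then show ?thesis using du[OF that] by (rule DERIV_cong_ev[OF refl _ refl, THEN iffD2])
    qed
    have fm_derivs: "deriv (\<lambda>s. f s powr m) r = u1 r" "deriv (deriv (\<lambda>s. f s powr m)) r = u2 r"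
      using deriv_deriv_on_greaterThan[of 0 "\<lambda>s. f s powr m" u1 u2 r] dfm du1 \<open>r > 0\<close> by auto
    \<comment> \<open>Since \<open>r powr (N + 1) * u1 r = - N * p (T r)\<close>, the radial
      Laplacian sees only the derivative of \<open>p\<close>.\<close>
    have "u2 r + (real n - 1) / r * u1 r =
        - N * N * \<sigma> * K * r powr (- N - 2) * T r * v (T r) powr (\<gamma> - 1) * (p (T r) - \<theta> * v (T r))"
    proof -
      have "real n - 1 = N + 1" by (simp add: N)
      moreover have "r powr (- N - 2) = r powr (- N - 1) / r"
        using \<open>r > 0\<close> by (simp add: powr_diff power2_eq_square)
      ultimately show ?thesis
        by (simp add: u2_def u1_def algebra_simps diff_divide_distrib add_divide_distrib)
    qed
    \<comment> \<open>The choice of \<open>K\<close> makes the diffusion term the exact negative of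
      the drift term.\<close>
    moreover have "(real n - 1) / m * (- N * N * \<sigma> * K) = \<beta> * \<gamma> * N"
      using K_mult m by (simp add: \<gamma> N field_simps)
    ultimately have "(real n - 1) / m * (u2 r + (real n - 1) / r * u1 r) =
        \<beta> * \<gamma> * N * r powr (- N - 2) * T r * v (T r) powr (\<gamma> - 1) * (p (T r) - \<theta> * v (T r))"
      by (metis (no_types, opaque_lifting) mult.assoc)
    with drift[OF \<open>r > 0\<close>]
    show "(real n - 1) / m * (deriv (deriv (\<lambda>s. f s powr m)) r + (real n - 1) / r * deriv (\<lambda>s. f s powr m) r)
        + \<alpha> * f r + \<beta> * r * deriv f r = 0"
      unfolding fm_derivs f_derivs(1)[OF \<open>r > 0\<close>] by simp
  qed (use \<open>C2_on {0<..} f\<close> f_pos in auto)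
  \<comment> \<open>Large \<open>r\<close> corresponds to small \<open>T r\<close>, so the decay at
    infinity is the limit of \<open>v\<close> at the singular point.\<close>
  have "filterlim T (at_right 0) at_top"
    unfolding filterlim_at T_def[abs_def] using N_pos sigma_pos
    by (auto intro!: tendsto_neg_powr filterlim_ident eventually_mono[OF eventually_gt_at_top[of 0]])
  then have "((\<lambda>r. v (T r)) \<longlongrightarrow> P) at_top"
    using sol unfolding solution_def by (auto intro: filterlim_compose)
  then have "((\<lambda>r. v (T r) powr \<gamma>) \<longlongrightarrow> P powr \<gamma>) at_top"
    using P by (intro tendsto_intros) auto
  moreover have "P powr \<gamma> = A"
    using A m_gamma by (simp add: P_eq powr_powr)
  moreover have "eventually (\<lambda>r. v (T r) powr \<gamma> = r powr ((real n - 2) / m) * f r) at_top"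
    using eventually_gt_at_top[of 0]
  proof eventually_elim
    case (elim r)
    have "(r powr (- N)) powr \<gamma> = r powr (- ((real n - 2) / m))"
      by (simp add: powr_powr \<gamma> N minus_divide_left)
    then show ?case
      using elim v_pos[OF T_pos[OF elim]]
      by (simp add: f_u u_def powr_mult powr_add[symmetric] mult.assoc[symmetric])
  qed
  ultimately show "((\<lambda>r. r powr ((real n - 2) / m) * f r) \<longlongrightarrow> A) at_top"
    using Lim_transform_eventually by metis
qed

text \<open>At \<open>x = r powr (- (N * \<sigma>))\<close> the numerator is exactly
  \<open>x * v x powr (\<gamma> - 1)\<close>, while
  \<open>ln x = N * \<sigma> * ln (inverse r)\<close>. The growth rate at infinity is thus
  multiplied by \<open>N * \<sigma>\<close>.\<close>

lemma profile_blowup_rate: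
  assumes "solution v p"
    and "\<And>x. x > 0 \<Longrightarrow> \<theta> * v x < p x" and "\<And>x. x > 0 \<Longrightarrow> p x \<le> v x"
  shows "((\<lambda>r. r\<^sup>2 * ((r powr (- N) * v (r powr (- (N * \<sigma>)))) powr \<gamma>) powr (1 - m) / ln (inverse r))
    \<longlongrightarrow> N * \<theta> / K) (at_right 0)"
proof -
  have v_pos: "v x > 0" if "x > 0" for x using assms(1) that by (simp add: solution_def)
  define T where "T r = r powr (- (N * \<sigma>))" for r :: real
  have N\<sigma>: "N * \<sigma> > 0" using N_pos sigma_pos by simp
  have "filterlim (\<lambda>r. exp (N * \<sigma> * - ln r)) at_top (at_right 0)"
    by (intro filterlim_compose[OF exp_at_top] filterlim_tendsto_pos_mult_at_top[OF tendsto_const N\<sigma>]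
        filterlim_compose[OF filterlim_uminus_at_top_at_bot ln_at_0])
  moreover have "eventually (\<lambda>r. exp (N * \<sigma> * - ln r) = T r) (at_right 0)"
    using eventually_at_right_less[of 0] by eventually_elim (simp add: T_def powr_def)
  ultimately have "filterlim T at_top (at_right 0)"
    using filterlim_cong[OF refl refl] by fast
  moreover have "((\<lambda>x. x * v x powr (\<gamma> - 1) / ln x) \<longlongrightarrow> \<theta> / (\<sigma> * K)) at_top"
    by (rule solution_log_growth) (use assms in auto)
  ultimately have "((\<lambda>r. T r * v (T r) powr (\<gamma> - 1) / ln (T r)) \<longlongrightarrow> \<theta> / (\<sigma> * K)) (at_right 0)"
    by (rule filterlim_compose[rotated])
  then have "((\<lambda>r. N * \<sigma> * (T r * v (T r) powr (\<gamma> - 1) / ln (T r))) \<longlongrightarrow> N * \<sigma> * (\<theta> / (\<sigma> * K))) (at_right 0)"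
    by (rule tendsto_mult[OF tendsto_const])
  moreover have "N * \<sigma> * (\<theta> / (\<sigma> * K)) = N * \<theta> / K"
    using sigma_pos by simp
  moreover have "eventually (\<lambda>r. N * \<sigma> * (T r * v (T r) powr (\<gamma> - 1) / ln (T r)) =
      r\<^sup>2 * ((r powr (- N) * v (T r)) powr \<gamma>) powr (1 - m) / ln (inverse r)) (at_right 0)"
    using eventually_at_right_less[of 0]
  proof eventually_elim
    case (elim r)
    have "\<gamma> * (1 - m) = \<gamma> - m * \<gamma>" by (simp add: algebra_simps)
    then have 1: "\<gamma> * (1 - m) = \<gamma> - 1" by (simp only: m_gamma)
    have 2: "r\<^sup>2 * r powr (- 2) = 1"
      using elim by (simp add: powr_minus)
    have 3: "ln (T r) = N * \<sigma> * ln (inverse r)"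
      using elim by (simp add: T_def ln_powr ln_inverse)
    have "r\<^sup>2 * ((r powr (- N) * v (T r)) powr \<gamma>) powr (1 - m)
        = (r\<^sup>2 * r powr (- 2)) * (T r * v (T r) powr (\<gamma> - 1))"
      unfolding powr_powr 1 using scaled_powr[OF elim v_pos[of "T r"]] elim by (simp add: T_def)
    also have "\<dots> = T r * v (T r) powr (\<gamma> - 1)"
      unfolding 2 by simp
    finally show ?case
      unfolding 3 using N_pos sigma_pos by simp
  qed
  ultimately have "((\<lambda>r. r\<^sup>2 * ((r powr (- N) * v (T r)) powr \<gamma>) powr (1 - m) / ln (inverse r))
      \<longlongrightarrow> N * \<theta> / K) (at_right 0)"
    using Lim_transform_eventually by simp
  then show ?thesis by (simp only: T_def)
qed

text \<open>The inverse passage: \<open>R\<close> inverts \<open>r powr (- (N * \<sigma>))\<close>,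
  and \<open>V\<close>, \<open>Q\<close> are the profile variables as functions of \<open>r\<close>.
  No sign of the drift is presumed, so uniqueness covers every classical solution with the given
  decay.\<close>

lemma profile_of_radial_solution:
  assumes sol: "radial_solution n m \<alpha> \<beta> g"
    and lim: "((\<lambda>r. r powr ((real n - 2) / m) * g r) \<longlongrightarrow> A) at_top"
  obtains v p where "solution v p" "\<And>r. r > 0 \<Longrightarrow> v (r powr (- (N * \<sigma>))) = r powr N * g r powr m"
proof -
  have N\<sigma>: "N * \<sigma> > 0" using N_pos sigma_pos by simp
  have g_pos: "g r > 0" if "r > 0" for r using sol that by (simp add: radial_solution_def)
  have dg: "(g has_real_derivative deriv g r) (at r)" "(deriv g has_real_derivative deriv (deriv g) r) (at r)"
    if "r > 0" for r
    using sol that unfolding radial_solution_def C2_on_def by (auto simp: DERIV_deriv_iff_field_differentiable)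
  define u where "u r = g r powr m" for r
  define u1 where "u1 r = m * g r powr (m - 1) * deriv g r" for r
  define u2 where "u2 r = m * ((m - 1) * g r powr (m - 1 - 1) * deriv g r) * deriv g r
      + deriv (deriv g) r * (m * g r powr (m - 1))" for r
  have dg_powr: "((\<lambda>r. g r powr c) has_real_derivative c * g r powr (c - 1) * deriv g r) (at r)" if "r > 0" for r c
    using DERIV_fun_powr[OF dg(1)[OF that] g_pos[OF that], of c] by (simp add: mult_ac)
  have du: "(u has_real_derivative u1 r) (at r)" if "r > 0" for r
    unfolding u_def[abs_def] u1_def by (rule dg_powr[OF that])
  have du1: "(u1 has_real_derivative u2 r) (at r)" if "r > 0" for r
    unfolding u1_def[abs_def] u2_def by (intro DERIV_mult DERIV_cmult dg_powr dg that)
  have u_derivs: "deriv (\<lambda>s. g s powr m) r = u1 r" "deriv (deriv (\<lambda>s. g s powr m)) r = u2 r" if "r > 0" for r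
    using deriv_deriv_on_greaterThan[of 0 u u1 u2 r] du du1 that by (auto simp: u_def[abs_def])
  have ode: "(N + 1) / m * (u2 r + (N + 1) / r * u1 r) + \<alpha> * g r + \<beta> * r * deriv g r = 0" if "r > 0" for r
    using sol that unfolding radial_solution_def by (simp add: u_derivs N)

  define R where "R x = x powr (- (1 / (N * \<sigma>)))" for x :: real
  have R_pos: "R x > 0" if "x > 0" for x using that by (simp add: R_def)
  have dR: "(R has_real_derivative - (1 / (N * \<sigma>)) * R x / x) (at x)" if "x > 0" for x
    unfolding R_def[abs_def] by (rule has_derivative_scale[OF that])
  have R_inv: "R x powr (- (N * \<sigma>)) = x" if "x > 0" for x
    using that N_pos sigma_pos by (simp add: R_def powr_powr)
  define V where "V r = r powr N * u r" for r
  define Q where "Q r = - (1 / N) * (r powr (N + 1) * u1 r)" for r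
  have V_pos: "V r > 0" if "r > 0" for r
    using g_pos[OF that] that by (simp add: V_def u_def)
  have dV: "(V has_real_derivative N / r * (V r - Q r)) (at r)" if "r > 0" for r
  proof -
    have "(V has_real_derivative N * r powr N / r * u r + u1 r * r powr N) (at r)"
      unfolding V_def[abs_def] by (intro DERIV_mult has_derivative_scale du that)
    also have "N * r powr N / r * u r + u1 r * r powr N = N / r * (V r - Q r)"
      using that N_pos by (simp add: V_def Q_def powr_add field_simps)
    finally show ?thesis .
  qed
  have dQ: "(Q has_real_derivative - (\<beta> * \<gamma> * m / (N + 1)) * r powr (- (N * \<sigma>)) / r * V r powr (\<gamma> - 1) * (Q r - \<theta> * V r)) (at r)"
    if "r > 0" for r
  proof -
    have "(Q has_real_derivative - (1 / N) * ((N + 1) * r powr (N + 1) / r * u1 r + u2 r * r powr (N + 1))) (at r)"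
      unfolding Q_def[abs_def] by (intro DERIV_mult DERIV_cmult has_derivative_scale du1 that)
    \<comment> \<open>Up to its constant factor this is the divergence form of the radial
      Laplacian.\<close>
    also have "- (1 / N) * ((N + 1) * r powr (N + 1) / r * u1 r + u2 r * r powr (N + 1))
        = - (1 / N) * r powr (N + 1) * (u2 r + (N + 1) / r * u1 r)"
    proof -
      have "(N + 1) * r powr (N + 1) / r * u1 r + u2 r * r powr (N + 1)
          = r powr (N + 1) * (u2 r + (N + 1) / r * u1 r)"
        by (simp add: distrib_left)
      then show ?thesis by (simp only: mult.assoc)
    qed
    also have "u2 r + (N + 1) / r * u1 r = - (m / (N + 1)) * (\<alpha> * g r + \<beta> * r * deriv g r)"
    proof -
      have eq: "(N + 1) / m * (u2 r + (N + 1) / r * u1 r) = - (\<alpha> * g r + \<beta> * r * deriv g r)"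
        using ode[OF that] by linarith
      have "m / (N + 1) * ((N + 1) / m * (u2 r + (N + 1) / r * u1 r)) = u2 r + (N + 1) / r * u1 r"
        using m N_pos by simp
      then show ?thesis unfolding eq by (simp only: mult_minus_left mult_minus_right)
    qed
    also have "\<alpha> * g r + \<beta> * r * deriv g r =
        - \<beta> * \<gamma> * N * r powr (- N - 2) * r powr (- (N * \<sigma>)) * V r powr (\<gamma> - 1) * (Q r - \<theta> * V r)"
    proof -
      have u: "u r = r powr (- N) * V r"
        using that by (simp add: V_def mult.assoc[symmetric] powr_add[symmetric])
      have u1: "u1 r = - N * r powr (- N - 1) * Q r"
        using that N_pos by (simp add: Q_def powr_add[symmetric] mult.assoc[symmetric])
      have g: "g r = u r powr \<gamma>"
        using g_pos[OF that] m_gamma by (simp add: u_def powr_powr)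
      \<comment> \<open>This factor is reciprocal to the power \<open>g r powr (m - 1)\<close> in
        \<open>u1\<close>, so \<open>deriv g\<close> can be recovered from
        \<open>u1\<close>.\<close>
      have "u r powr (\<gamma> - 1) = g r powr (1 - m)"
        using m_gamma by (simp add: u_def powr_powr algebra_simps)
      then have "deriv g r = \<gamma> * u r powr (\<gamma> - 1) * u1 r"
        using g_pos[OF that] m_gamma
        by (simp add: u1_def powr_add[symmetric] mult_ac)
      then show ?thesis
        using drift_identity[OF that V_pos[OF that], of "Q r"] g u u1 by metis
    qed
    also have "- (1 / N) * r powr (N + 1) * (- (m / (N + 1)) *
        (- \<beta> * \<gamma> * N * r powr (- N - 2) * r powr (- (N * \<sigma>)) * V r powr (\<gamma> - 1) * (Q r - \<theta> * V r)))
      = - (\<beta> * \<gamma> * m / (N + 1)) * (r powr (N + 1) * r powr (- N - 2)) * r powr (- (N * \<sigma>)) * V r powr (\<gamma> - 1) * (Q r - \<theta> * V r)"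
      using N_pos by simp
    also have "r powr (N + 1) * r powr (- N - 2) = 1 / r"
      using that by (simp add: powr_add[symmetric] powr_minus_divide)
    finally show ?thesis by simp
  qed
  define v where "v x = V (R x)" for x
  define p where "p x = Q (R x)" for x
  have "solution v p"
    unfolding solution_def
  proof (intro conjI allI impI)
    fix x :: real assume x: "x > 0"
    show "v x > 0" using V_pos[OF R_pos[OF x]] by (simp add: v_def)
    have "(v has_real_derivative N / R x * (V (R x) - Q (R x)) * (- (1 / (N * \<sigma>)) * R x / x)) (at x)"
      unfolding v_def[abs_def] by (rule DERIV_chain2[OF dV[OF R_pos[OF x]] dR[OF x]])
    also have "N / R x * (V (R x) - Q (R x)) * (- (1 / (N * \<sigma>)) * R x / x) = (p x - v x) / (\<sigma> * x)"
      using R_pos[OF x] x N_pos sigma_pos by (simp add: v_def p_def divide_simps)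
    finally show "(v has_real_derivative (p x - v x) / (\<sigma> * x)) (at x)" .
    have "(p has_real_derivative - (\<beta> * \<gamma> * m / (N + 1)) * R x powr (- (N * \<sigma>)) / R x * V (R x) powr (\<gamma> - 1)
        * (Q (R x) - \<theta> * V (R x)) * (- (1 / (N * \<sigma>)) * R x / x)) (at x)"
      unfolding p_def[abs_def] by (rule DERIV_chain2[OF dQ[OF R_pos[OF x]] dR[OF x]])
    also have "- (\<beta> * \<gamma> * m / (N + 1)) * R x powr (- (N * \<sigma>)) / R x * V (R x) powr (\<gamma> - 1)
        * (Q (R x) - \<theta> * V (R x)) * (- (1 / (N * \<sigma>)) * R x / x)
        = (\<beta> / ((N + 1) * N * \<sigma>)) * v x powr (\<gamma> - 1) * (p x - \<theta> * v x)"
      unfolding R_inv[OF x] v_def[symmetric] p_def[symmetric] using R_pos[OF x] x m by (simp add: \<gamma>)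
    also have "\<beta> / ((N + 1) * N * \<sigma>) = - K" by (simp add: K_eq)
    finally show "(p has_real_derivative - K * v x powr (\<gamma> - 1) * (p x - \<theta> * v x)) (at x)" .
  next
    have "filterlim (\<lambda>x. exp (1 / (N * \<sigma>) * - ln x)) at_top (at_right 0)"
      using N\<sigma>
      by (intro filterlim_compose[OF exp_at_top] filterlim_tendsto_pos_mult_at_top[OF tendsto_const]
          filterlim_compose[OF filterlim_uminus_at_top_at_bot ln_at_0]) auto
    moreover have "eventually (\<lambda>x. exp (1 / (N * \<sigma>) * - ln x) = R x) (at_right 0)"
      using eventually_at_right_less[of 0] by eventually_elim (simp add: R_def powr_def)
    ultimately have "filterlim R at_top (at_right 0)"
      using filterlim_cong[OF refl refl] by fast
    moreover have "(V \<longlongrightarrow> P) at_top"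
    proof -
      have "((\<lambda>r. (r powr ((real n - 2) / m) * g r) powr m) \<longlongrightarrow> A powr m) at_top"
        using A by (intro tendsto_intros lim) auto
      moreover have "eventually (\<lambda>r. (r powr ((real n - 2) / m) * g r) powr m = V r) at_top"
        using eventually_gt_at_top[of 0]
      proof eventually_elim
        case (elim r)
        then show ?case
          using g_pos[OF elim] m by (simp add: powr_mult powr_powr V_def u_def N)
      qed
      ultimately show ?thesis
        unfolding P_eq by (rule Lim_transform_eventually)
    qed
    ultimately show "(v \<longlongrightarrow> P) (at_right 0)"
      unfolding v_def[abs_def] by (rule filterlim_compose[rotated])
  qed
  moreover have "v (r powr (- (N * \<sigma>))) = r powr N * g r powr m" if "r > 0" for r
  proof -
    have "R (r powr (- (N * \<sigma>))) = r"
      using that N_pos sigma_pos by (simp add: R_def powr_powr)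
    then show ?thesis by (simp add: v_def V_def u_def)
  qed
  ultimately show ?thesis by (rule that)
qed

text \<open>Both solutions give profiles with the same limit \<open>P\<close> at 0, hence the same
  \<open>v\<close>; the power \<open>m\<close> is then undone by the power
  \<open>\<gamma>\<close>.\<close>

lemma radial_solution_unique:
  assumes "radial_solution n m \<alpha> \<beta> f" "((\<lambda>r. r powr ((real n - 2) / m) * f r) \<longlongrightarrow> A) at_top"
    and "radial_solution n m \<alpha> \<beta> g" "((\<lambda>r. r powr ((real n - 2) / m) * g r) \<longlongrightarrow> A) at_top"
    and r: "r > 0"
  shows "g r = f r"
proof -
  obtain v p where v: "solution v p"
    "\<And>r. r > 0 \<Longrightarrow> v (r powr (- (N * \<sigma>))) = r powr N * f r powr m"
    using profile_of_radial_solution[OF assms(1,2)] by blast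
  obtain w q where w: "solution w q"
    "\<And>r. r > 0 \<Longrightarrow> w (r powr (- (N * \<sigma>))) = r powr N * g r powr m"
    using profile_of_radial_solution[OF assms(3,4)] by blast
  have "v (r powr (- (N * \<sigma>))) = w (r powr (- (N * \<sigma>)))"
    using solution_unique[OF v(1) w(1)] r by simp
  then have "f r powr m = g r powr m"
    using v(2)[OF r] w(2)[OF r] r by simp
  then have "(f r powr m) powr \<gamma> = (g r powr m) powr \<gamma>" by simp
  moreover have "f r > 0" "g r > 0"
    using assms by (simp_all add: radial_solution_def)
  ultimately show ?thesis
    using m_gamma by (simp add: powr_powr)
qed

end

theorem theorem1p1:
  fixes n :: nat and m \<alpha> \<beta> A :: real
  assumes "n \<ge> 3"
    and "0 < m" and "m < (real n - 2) / real n"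
    and "\<beta> < 0"
    and "\<alpha> = 2 * \<beta> / (1 - m)"
    and "A > 0"
  shows "\<exists>f.
      (radial_solution n m \<alpha> \<beta> f \<and>
       ((\<lambda>r. r powr ((real n - 2) / m) * f r) \<longlongrightarrow> A) at_top) \<and>
      (\<forall>g. radial_solution n m \<alpha> \<beta> g \<and>
           ((\<lambda>r. r powr ((real n - 2) / m) * g r) \<longlongrightarrow> A) at_top
           \<longrightarrow> (\<forall>r>0. g r = f r)) \<and>
      ((\<lambda>r. r\<^sup>2 * f r powr (1 - m) / ln (inverse r)) \<longlongrightarrow>
         2 * (real n - 1) * (real n - 2 - real n * m) / ((1 - m) * \<bar>\<beta>\<bar>)) (at_right 0) \<and>
      (\<forall>r>0. \<alpha> * f r + \<beta> * r * deriv f r > 0)"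
proof -
  define N where "N = real n - 2"
  define \<gamma> where "\<gamma> = 1 / m"
  define \<theta> where "\<theta> = 2 * m / ((1 - m) * N)"
  define \<sigma> where "\<sigma> = (\<gamma> - 1) * (1 - \<theta>)"
  define K where "K = - \<beta> / ((N + 1) * N * \<sigma>)"
  have N: "N > 0" using assms(1) by (simp add: N_def)
  \<comment> \<open>This form of the bound on \<open>m\<close> yields both \<open>m < 1\<close> and
    \<open>\<theta> < 1\<close>.\<close>
  have mn: "real n * m < N" using assms(1,3) by (simp add: N_def field_simps)
  then have "real n * m < real n * 1" by (simp add: N_def)
  then have m: "m < 1" using assms(1) by (simp only: mult_less_cancel_left_pos)
  have \<theta>: "0 < \<theta>" "\<theta> < 1"
    using assms(2) m N mn by (simp_all add: \<theta>_def N_def field_simps)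
  have \<gamma>: "\<gamma> > 1" using assms(2) m by (simp add: \<gamma>_def)
  then have \<sigma>: "\<sigma> > 0" using \<theta> by (simp add: \<sigma>_def)
  have K: "K > 0"
    unfolding K_def using assms(4) N \<sigma> by (intro divide_pos_pos mult_pos_pos) auto
  interpret rp: radial_profile \<gamma> \<theta> \<sigma> K "A powr m" n m \<alpha> \<beta> A N
    by unfold_locales
      (rule N_def \<gamma>_def \<theta>_def \<sigma>_def K_def | use assms m \<theta> \<gamma> K in simp)+
  obtain v p where vp: "rp.solution v p" "\<And>x. x > 0 \<Longrightarrow> \<theta> * v x < p x" "\<And>x. x > 0 \<Longrightarrow> p x \<le> v x"
    using rp.solution_exists by blast
  define f where "f r = (r powr (- N) * v (r powr (- (N * \<sigma>)))) powr \<gamma>" for r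
  note f = rp.radial_solution_of_profile[OF vp(1), folded f_def]
  have rate: "N * \<theta> / K = 2 * (real n - 1) * (real n - 2 - real n * m) / ((1 - m) * \<bar>\<beta>\<bar>)"
  proof -
    \<comment> \<open>From \<open>N * \<sigma> = N * (\<gamma> - 1) - 2\<close>; this is the origin
      of the factor \<open>n - 2 - n * m\<close> in the limit.\<close>
    have 1: "N * \<sigma> = (N - real n * m) / m"
      using rp.N_sigma assms(2) by (simp add: \<gamma>_def N_def field_simps)
    have 2: "N * \<theta> = 2 * m / (1 - m)"
      using N m by (simp add: \<theta>_def)
    have "N * \<theta> / K = N * \<theta> * ((N + 1) * (N * \<sigma>)) / \<bar>\<beta>\<bar>"
      using assms(4) N \<sigma> by (simp add: K_def field_simps)
    also have "\<dots> = 2 * (N + 1) * (N - real n * m) / ((1 - m) * \<bar>\<beta>\<bar>)"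
      unfolding 1 2 using assms(2) by simp
    also have "N + 1 = real n - 1" by (simp add: N_def)
    finally show ?thesis by (simp only: N_def)
  qed
  show ?thesis
  proof (intro exI[of _ f] conjI allI impI)
    show "((\<lambda>r. r\<^sup>2 * f r powr (1 - m) / ln (inverse r)) \<longlongrightarrow>
         2 * (real n - 1) * (real n - 2 - real n * m) / ((1 - m) * \<bar>\<beta>\<bar>)) (at_right 0)"
      using rp.profile_blowup_rate[OF vp] unfolding rate f_def .
    show "g r = f r" if "radial_solution n m \<alpha> \<beta> g \<and>
        ((\<lambda>r. r powr ((real n - 2) / m) * g r) \<longlongrightarrow> A) at_top" "r > 0" for g r
      using rp.radial_solution_unique[OF f(1,2)] that by blast
    show "\<alpha> * f r + \<beta> * r * deriv f r > 0" if r: "r > 0" for r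
    proof -
      have "v (r powr (- (N * \<sigma>))) > 0" using vp(1) r by (simp add: rp.solution_def)
      then show ?thesis
        unfolding f(3)[OF r] using r assms(4) N \<gamma> vp(2)[of "r powr (- (N * \<sigma>))"]
        by (intro mult_pos_pos) auto
    qed
  qed (rule f)+
qed

end
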